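(* Let $n\ge 4$ and let $M$ be a locally strongly convex hypersurface in $\mathbb{A}^{n+1}$. (i) If at every point $x$ of $M$ the affine shape operator $\mathcal{S}_x$ has exactly two distinct affine principal curvatures $\lambda_1$ and $\lambda_2$, then $R^{\ast}\cdot R^{\ast}=L\,Q(h,R^{\ast})$ holds on $M$, with the function $L$ defined by $L=L(x)=\lambda_1\lambda_2$. (ii) If at every point $x$ of $M$ the affine shape operator $\mathcal{S}_x$ has exactly two distinct affine principal curvatures $\lambda_1$ and $\lambda_2$ of multiplicities $k$ and $n-k$, respectively, such that $$(k-1)\lambda_1+(n-k-1)\lambda_2\neq 0,\qquad 2\le k\le n-2,\qquad(\ast)$$ then, with $L=\lambda_1\lambda_2$, $$R^{\ast}=\frac{\phi}{2}\,(\mathrm{Ric}(R^{\ast})-L\,h)\wedge(\mathrm{Ric}(R^{\ast})-L\,h)\qquad(\ast\ast)$$ holds on $M$, where $\phi$ is some function. (iii) If at every point $x$ of $M$ the affine shape operator $\mathcal{S}_x$ has exactly two distinct affine principal curvatures $\lambda_1$ and $\lambda_2$ of multiplicities $k\ge2$ and $n-k\geq 2$ such that $\lambda_1,\lambda_2>0$ (or $\lambda_1,\lambda_2<0$), or $\lambda_1\neq0$ and $\lambda_2=0$ (or $\lambda_1=0$ and $\lambda_2\ne0$), then $(\ast)$ and $(\ast\ast)$, with $L=\lambda_1\lambda_2$, hold on $M$, where $\phi$ is some function. (iv) If $n=4$ and the affine shape operator $\mathcal{S}_x$ has at every point $x$ of $M$ exactly two distinct affine principal curvatures $\lambda_1$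 and $\lambda_2$, both of multiplicity $2$, then $M$ is an affine $2$-quasi-umbilical hypersurface.
   Context: $\mathbb{A}^{n+1}$ is $\mathbb{R}^{n+1}$ with its standard flat connection and the volume form given by the determinant. A hypersurface $M\subset\mathbb{A}^{n+1}$ (connected, smooth) is non-degenerate if its affine fundamental form is non-degenerate; it then carries its affine normal $\xi$, the Blaschke-Berwald metric $h$, the induced connection $\nabla$ and the affine shape operator $\mathcal{S}$ (Gauss and Weingarten formulas $\widetilde\nabla_XY=\nabla_XY+h(X,Y)\xi$, $\widetilde\nabla_X\xi=-\mathcal{S}X$); the operator $\mathcal{S}$ is $h$-self-adjoint. For a locally strongly convex hypersurface $h$ is positive definite, and the (real) eigenvalues of $\mathcal{S}_x$ are called the affine principal curvatures at $x$. Set $S(X,Y)=h(X,\mathcal{S}Y)$. $M$ (with $n\geq4$) is affine $2$-quasi-umbilical at a point $x$ (at which $\mathcal{S}_x$ is not a multiple of the identity) if $\mathrm{rank}(S-\rho h)=2$ at $x$ for some $\rho\in\mathbb{R}$; it is an affine $2$-quasi-umbilical hypersurface if this holds at every point. For symmetric $(0,2)$-tensors $E,F$ the Kulkarni-Nomizu product is $(E\wedge F)(X_1,X_2,X_3,X_4)=E(X_1,X_4)F(X_2,X_3)+E(X_2,X_3)F(X_1,X_4)-E(X_1,X_3)F(X_2,X_4)-E(X_2,X_4)F(X_1,X_3)$. The Opozda-Verstraelen affine curvature tensor is $R^{\ast}=\frac12 S\wedge S$, with Ricci tensor $\mathrm{Ric}(R^{\ast})(X,Y)=\sum_jR^{\ast}(e_j,X,Y,e_j)$,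 $(e_j)$ an $h$-orthonormal basis. For a $(0,4)$-tensor $B$ with the algebraic symmetries of a curvature tensor, let $\mathcal{B}(X,Y)$ be the endomorphism with $h(\mathcal{B}(X_1,X_2)X_3,X_4)=B(X_1,X_2,X_3,X_4)$. For a $(0,k)$-tensor $T$, $(B\cdot T)(X_1,\dots,X_k,X,Y)=-\sum_{i=1}^{k}T(X_1,\dots,\mathcal{B}(X,Y)X_i,\dots,X_k)$. For a symmetric $(0,2)$-tensor $A$, let $(X\wedge_AY)Z=A(Y,Z)X-A(X,Z)Y$ and $Q(A,T)(X_1,\dots,X_k,X,Y)=-\sum_{i=1}^{k}T(X_1,\dots,(X\wedge_AY)X_i,\dots,X_k)$. *)

theory Defs
  imports "HOL-Analysis.Analysis"
begin

text \<open>
  The ambient affine space of dimension n + 1 is \<open>real ^ ('n option)\<close> with n = \<open>CARD('n)\<close>,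
  its flat connection being componentwise differentiation.
\<close>

section \<open>Smooth maps on open sets\<close>

primrec Ck_on :: "nat \<Rightarrow> ('v::real_normed_vector \<Rightarrow> 'w::real_normed_vector) \<Rightarrow> 'v set \<Rightarrow> bool" where
  "Ck_on 0 f U \<longleftrightarrow> continuous_on U f"
| "Ck_on (Suc m) f U \<longleftrightarrow>
     (\<forall>u\<in>U. f differentiable (at u)) \<and> (\<forall>v. Ck_on m (\<lambda>u. frechet_derivative f (at u) v) U)"

definition smooth_on :: "('v::real_normed_vector \<Rightarrow> 'w::real_normed_vector) \<Rightarrow> 'v set \<Rightarrow> bool" where
  "smooth_on f U \<longleftrightarrow> (\<forall>m. Ck_on m f U)"

abbreviation D1 :: "('v::real_normed_vector \<Rightarrow> 'w::real_normed_vector) \<Rightarrow> 'v \<Rightarrow> 'v \<Rightarrow> 'w" where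
  "D1 f u \<equiv> frechet_derivative f (at u)"

abbreviation D2 :: "('v::real_normed_vector \<Rightarrow> 'w::real_normed_vector) \<Rightarrow> 'v \<Rightarrow> 'v \<Rightarrow> 'v \<Rightarrow> 'w" where
  "D2 f u a b \<equiv> D1 (\<lambda>w. D1 f w b) u a"

section \<open>Hypersurfaces\<close>

text \<open>
  A hypersurface is a connected manifold \<open>M\<close> with an immersion \<open>F\<close>; a hypersurface that is a
  subset \<open>A\<close> of the ambient space is the case \<open>M = top_of_set A\<close>, \<open>F = id\<close>.  No atlas has to be
  given: the smooth structure of \<open>M\<close> is determined by \<open>F\<close>, because any two local parametrizations
  in the following sense are related by a smooth change of parameters.
\<close>

definition local_param ::
  "'a topology \<Rightarrow> ('a \<Rightarrow> real^('n::finite option)) \<Rightarrow> (real^'n) set \<Rightarrow> (real^'n \<Rightarrow> 'a) \<Rightarrow> bool" where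
  "local_param M F U \<psi> \<longleftrightarrow>
     open U \<and> openin M (\<psi> ` U) \<and>
     homeomorphic_map (top_of_set U) (subtopology M (\<psi> ` U)) \<psi> \<and>
     smooth_on (F \<circ> \<psi>) U \<and> (\<forall>u\<in>U. inj (D1 (F \<circ> \<psi>) u))"

definition hypersurface :: "'a topology \<Rightarrow> ('a \<Rightarrow> real^('n::finite option)) \<Rightarrow> bool" where
  "hypersurface M F \<longleftrightarrow>
     topspace M \<noteq> {} \<and> connected_space M \<and> Hausdorff_space M \<and> second_countable M \<and>
     (\<forall>x\<in>topspace M. \<exists>U \<psi>. local_param M F U \<psi> \<and> x \<in> \<psi> ` U)"

section \<open>Affine fundamental form and affine normal\<close>

text \<open>
  Gauss formula for a parametrization \<open>f\<close>: the component of the second derivative along a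
  transversal vector \<open>w\<close>, with respect to the splitting (tangent space) + (span of \<open>w\<close>).
\<close>

definition affine_form ::
  "(real^'n::finite \<Rightarrow> real^('n option)) \<Rightarrow> real^('n option) \<Rightarrow> real^'n \<Rightarrow> real^'n \<Rightarrow> real^'n \<Rightarrow> real" where
  "affine_form f w u a b = (THE c. D2 f u a b - c *\<^sub>R w \<in> range (D1 f u))"

text \<open>Determinant of the coordinate frame of \<open>f\<close> at \<open>u\<close> completed by \<open>w\<close>; the position of \<open>w\<close> in
  the frame affects only the sign.\<close>

definition frame_det ::
  "(real^'n::finite \<Rightarrow> real^('n option)) \<Rightarrow> real^('n option) \<Rightarrow> real^'n \<Rightarrow> real" where
  "frame_det f w u =
     det (\<chi> r c. (case c of None \<Rightarrow> w | Some i \<Rightarrow> D1 f u (axis i 1)) $ r)"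

text \<open>
  The affine normal is the transversal field \<open>\<xi>\<close> that is equiaffine (its derivatives are tangent, so
  that the volume form induced by \<open>\<xi>\<close> is parallel) and whose induced volume form is the
  volume form of the metric \<open>h\<close>.  These conditions determine \<open>\<xi>\<close> up to sign.  Transversality and
  the volume condition force \<open>h\<close> to be non-degenerate.
\<close>

definition affine_normal ::
  "'a topology \<Rightarrow> ('a \<Rightarrow> real^('n::finite option)) \<Rightarrow> ('a \<Rightarrow> real^('n option)) \<Rightarrow> bool" where
  "affine_normal M F \<xi> \<longleftrightarrow>
     (\<forall>U \<psi>. local_param M F U \<psi> \<longrightarrow>
        smooth_on (\<xi> \<circ> \<psi>) U \<and>
        (\<forall>u\<in>U.
           \<xi> (\<psi> u) \<notin> range (D1 (F \<circ> \<psi>) u) \<and>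
           (\<forall>a. D1 (\<xi> \<circ> \<psi>) u a \<in> range (D1 (F \<circ> \<psi>) u)) \<and>
           \<bar>frame_det (F \<circ> \<psi>) (\<xi> (\<psi> u)) u\<bar> =
             sqrt \<bar>det (\<chi> i j. affine_form (F \<circ> \<psi>) (\<xi> (\<psi> u)) u (axis i 1) (axis j 1))\<bar>))"

section \<open>Tangent spaces, Blaschke metric and shape operator\<close>

text \<open>
  The tangent space is realised as a linear subspace of the ambient vector space.  It, the metric
  and the shape operator do not depend on the local parametrization around the point, so one of
  them is picked.
\<close>

definition param_at ::
  "'a topology \<Rightarrow> ('a \<Rightarrow> real^('n::finite option)) \<Rightarrow> 'a \<Rightarrow> (real^'n \<Rightarrow> 'a) \<times> (real^'n)" where
  "param_at M F x = (SOME (\<psi>, u). \<exists>U. local_param M F U \<psi> \<and> u \<in> U \<and> \<psi> u = x)"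

definition tangent_space ::
  "'a topology \<Rightarrow> ('a \<Rightarrow> real^('n::finite option)) \<Rightarrow> 'a \<Rightarrow> (real^('n option)) set" where
  "tangent_space M F x = (case param_at M F x of (\<psi>, u) \<Rightarrow> range (D1 (F \<circ> \<psi>) u))"

definition blaschke_metric ::
  "'a topology \<Rightarrow> ('a \<Rightarrow> real^('n::finite option)) \<Rightarrow> ('a \<Rightarrow> real^('n option)) \<Rightarrow> 'a \<Rightarrow>
     real^('n option) \<Rightarrow> real^('n option) \<Rightarrow> real" where
  "blaschke_metric M F \<xi> x X Y =
     (case param_at M F x of (\<psi>, u) \<Rightarrow>
        affine_form (F \<circ> \<psi>) (\<xi> x) u (inv (D1 (F \<circ> \<psi>) u) X) (inv (D1 (F \<circ> \<psi>) u) Y))"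

definition shape_operator ::
  "'a topology \<Rightarrow> ('a \<Rightarrow> real^('n::finite option)) \<Rightarrow> ('a \<Rightarrow> real^('n option)) \<Rightarrow> 'a \<Rightarrow>
     real^('n option) \<Rightarrow> real^('n option)" where
  "shape_operator M F \<xi> x X =
     (case param_at M F x of (\<psi>, u) \<Rightarrow> - D1 (\<xi> \<circ> \<psi>) u (inv (D1 (F \<circ> \<psi>) u) X))"

text \<open>Definiteness of the affine fundamental form, which fixes the sign of the affine normal by the
  usual convention that the form is positive.\<close>

definition locally_strongly_convex ::
  "'a topology \<Rightarrow> ('a \<Rightarrow> real^('n::finite option)) \<Rightarrow> ('a \<Rightarrow> real^('n option)) \<Rightarrow> bool" where
  "locally_strongly_convex M F \<xi> \<longleftrightarrow>
     (\<forall>x\<in>topspace M. \<forall>X\<in>tangent_space M F x. X \<noteq> 0 \<longrightarrow> blaschke_metric M F \<xi> x X X > 0)"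

definition principal_curvatures ::
  "'a topology \<Rightarrow> ('a \<Rightarrow> real^('n::finite option)) \<Rightarrow> ('a \<Rightarrow> real^('n option)) \<Rightarrow> 'a \<Rightarrow> real set" where
  "principal_curvatures M F \<xi> x =
     {l. \<exists>X\<in>tangent_space M F x. X \<noteq> 0 \<and> shape_operator M F \<xi> x X = l *\<^sub>R X}"

definition multiplicity_at ::
  "'a topology \<Rightarrow> ('a \<Rightarrow> real^('n::finite option)) \<Rightarrow> ('a \<Rightarrow> real^('n option)) \<Rightarrow> 'a \<Rightarrow> real \<Rightarrow> nat" where
  "multiplicity_at M F \<xi> x l =
     dim {X \<in> tangent_space M F x. shape_operator M F \<xi> x X = l *\<^sub>R X}"

definition shape_tensor ::
  "'a topology \<Rightarrow> ('a \<Rightarrow> real^('n::finite option)) \<Rightarrow> ('a \<Rightarrow> real^('n option)) \<Rightarrow> 'a \<Rightarrow>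
     real^('n option) \<Rightarrow> real^('n option) \<Rightarrow> real" where
  "shape_tensor M F \<xi> x X Y = blaschke_metric M F \<xi> x X (shape_operator M F \<xi> x Y)"

section \<open>Algebra of tensors on a hyperplane\<close>

text \<open>Tensors on a tangent space \<open>V\<close> are curried functions on the ambient space, of which only the
  values on \<open>V\<close> matter.\<close>

definition kulkarni_nomizu :: "('v \<Rightarrow> 'v \<Rightarrow> real) \<Rightarrow> ('v \<Rightarrow> 'v \<Rightarrow> real) \<Rightarrow> 'v \<Rightarrow> 'v \<Rightarrow> 'v \<Rightarrow> 'v \<Rightarrow> real" where
  "kulkarni_nomizu E F X1 X2 X3 X4 =
     E X1 X4 * F X2 X3 + E X2 X3 * F X1 X4 - E X1 X3 * F X2 X4 - E X2 X4 * F X1 X3"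

definition curvature_operator ::
  "'v set \<Rightarrow> ('v \<Rightarrow> 'v \<Rightarrow> real) \<Rightarrow> ('v \<Rightarrow> 'v \<Rightarrow> 'v \<Rightarrow> 'v \<Rightarrow> real) \<Rightarrow> 'v \<Rightarrow> 'v \<Rightarrow> 'v \<Rightarrow> 'v" where
  "curvature_operator V h B X1 X2 X3 =
     (THE W. W \<in> V \<and> (\<forall>X4\<in>V. h W X4 = B X1 X2 X3 X4))"

definition dot_tensor ::
  "'v set \<Rightarrow> ('v \<Rightarrow> 'v \<Rightarrow> real) \<Rightarrow> ('v \<Rightarrow> 'v \<Rightarrow> 'v \<Rightarrow> 'v \<Rightarrow> real) \<Rightarrow> ('v \<Rightarrow> 'v \<Rightarrow> 'v \<Rightarrow> 'v \<Rightarrow> real) \<Rightarrow>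
     'v \<Rightarrow> 'v \<Rightarrow> 'v \<Rightarrow> 'v \<Rightarrow> 'v \<Rightarrow> 'v \<Rightarrow> real" where
  "dot_tensor V h B T X1 X2 X3 X4 X Y =
     (let R = curvature_operator V h B X Y in
      - (T (R X1) X2 X3 X4 + T X1 (R X2) X3 X4 + T X1 X2 (R X3) X4 + T X1 X2 X3 (R X4)))"

definition wedge_operator ::
  "('v::real_vector \<Rightarrow> 'v \<Rightarrow> real) \<Rightarrow> 'v \<Rightarrow> 'v \<Rightarrow> 'v \<Rightarrow> 'v" where
  "wedge_operator A X Y Z = A Y Z *\<^sub>R X - A X Z *\<^sub>R Y"

definition Q_tensor ::
  "('v::real_vector \<Rightarrow> 'v \<Rightarrow> real) \<Rightarrow> ('v \<Rightarrow> 'v \<Rightarrow> 'v \<Rightarrow> 'v \<Rightarrow> real) \<Rightarrow>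
     'v \<Rightarrow> 'v \<Rightarrow> 'v \<Rightarrow> 'v \<Rightarrow> 'v \<Rightarrow> 'v \<Rightarrow> real" where
  "Q_tensor A T X1 X2 X3 X4 X Y =
     (let W = wedge_operator A X Y in
      - (T (W X1) X2 X3 X4 + T X1 (W X2) X3 X4 + T X1 X2 (W X3) X4 + T X1 X2 X3 (W X4)))"

definition is_frame :: "(real^('n::finite option)) set \<Rightarrow> ('n \<Rightarrow> real^('n option)) \<Rightarrow> bool" where
  "is_frame V b \<longleftrightarrow> inj b \<and> independent (range b) \<and> span (range b) = V"

text \<open>The following two notions do not depend on the chosen basis.\<close>

definition ricci ::
  "(real^('n::finite option)) set \<Rightarrow> (real^('n option) \<Rightarrow> real^('n option) \<Rightarrow> real) \<Rightarrow>
   (real^('n option) \<Rightarrow> real^('n option) \<Rightarrow> real^('n option) \<Rightarrow> real^('n option) \<Rightarrow> real) \<Rightarrow>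
   real^('n option) \<Rightarrow> real^('n option) \<Rightarrow> real" where
  "ricci V h B X Y =
     (let e = (SOME e. is_frame V e \<and> (\<forall>i j. h (e i) (e j) = (if i = j then 1 else 0)))
      in \<Sum>j\<in>UNIV. B (e j) X Y (e j))"

definition form_rank ::
  "(real^('n::finite option)) set \<Rightarrow> (real^('n option) \<Rightarrow> real^('n option) \<Rightarrow> real) \<Rightarrow> nat" where
  "form_rank V E =
     (let b = (SOME b. is_frame V b) in rank ((\<chi> i j. E (b i) (b j)) :: real^'n^'n))"

section \<open>Opozda-Verstraelen curvature tensor and affine 2-quasi-umbilical hypersurfaces\<close>

definition Rstar ::
  "'a topology \<Rightarrow> ('a \<Rightarrow> real^('n::finite option)) \<Rightarrow> ('a \<Rightarrow> real^('n option)) \<Rightarrow> 'a \<Rightarrow>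
     real^('n option) \<Rightarrow> real^('n option) \<Rightarrow> real^('n option) \<Rightarrow> real^('n option) \<Rightarrow> real" where
  "Rstar M F \<xi> x X1 X2 X3 X4 =
     1 / 2 * kulkarni_nomizu (shape_tensor M F \<xi> x) (shape_tensor M F \<xi> x) X1 X2 X3 X4"

definition Ric_Rstar ::
  "'a topology \<Rightarrow> ('a \<Rightarrow> real^('n::finite option)) \<Rightarrow> ('a \<Rightarrow> real^('n option)) \<Rightarrow> 'a \<Rightarrow>
     real^('n option) \<Rightarrow> real^('n option) \<Rightarrow> real" where
  "Ric_Rstar M F \<xi> x =
     ricci (tangent_space M F x) (blaschke_metric M F \<xi> x) (Rstar M F \<xi> x)"

definition two_quasi_umbilical_at ::
  "'a topology \<Rightarrow> ('a \<Rightarrow> real^('n::finite option)) \<Rightarrow> ('a \<Rightarrow> real^('n option)) \<Rightarrow> 'a \<Rightarrow> bool" where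
  "two_quasi_umbilical_at M F \<xi> x \<longleftrightarrow>
     CARD('n) \<ge> 4 \<and>
     \<not> (\<exists>c. \<forall>X\<in>tangent_space M F x. shape_operator M F \<xi> x X = c *\<^sub>R X) \<and>
     (\<exists>\<rho>. form_rank (tangent_space M F x)
            (\<lambda>X Y. shape_tensor M F \<xi> x X Y - \<rho> * blaschke_metric M F \<xi> x X Y) = 2)"

definition two_quasi_umbilical ::
  "'a topology \<Rightarrow> ('a \<Rightarrow> real^('n::finite option)) \<Rightarrow> ('a \<Rightarrow> real^('n option)) \<Rightarrow> bool" where
  "two_quasi_umbilical M F \<xi> \<longleftrightarrow> (\<forall>x\<in>topspace M. two_quasi_umbilical_at M F \<xi> x)"

section \<open>Conditions on the affine principal curvatures\<close>

definition two_curvatures ::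
  "'a topology \<Rightarrow> ('a \<Rightarrow> real^('n::finite option)) \<Rightarrow> ('a \<Rightarrow> real^('n option)) \<Rightarrow>
     'a \<Rightarrow> real \<Rightarrow> real \<Rightarrow> bool" where
  "two_curvatures M F \<xi> x l1 l2 \<longleftrightarrow> l1 \<noteq> l2 \<and> principal_curvatures M F \<xi> x = {l1, l2}"

definition two_curvatures_mult ::
  "'a topology \<Rightarrow> ('a \<Rightarrow> real^('n::finite option)) \<Rightarrow> ('a \<Rightarrow> real^('n option)) \<Rightarrow>
     'a \<Rightarrow> real \<Rightarrow> real \<Rightarrow> nat \<Rightarrow> bool" where
  "two_curvatures_mult M F \<xi> x l1 l2 k \<longleftrightarrow>
     two_curvatures M F \<xi> x l1 l2 \<and>
     multiplicity_at M F \<xi> x l1 = k \<and> multiplicity_at M F \<xi> x l2 = CARD('n) - k"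

end

theory Submission
  imports Defs
begin

text \<open>
  Let \<open>N\<close> be the conormal field of a parametrization \<open>f\<close>, i.e. \<open>N w \<bullet> y\<close> is the determinant of the
  coordinate frame of \<open>f\<close> at \<open>w\<close> completed by \<open>y\<close>.  The affine fundamental form is \<open>N \<bullet> D2 f\<close> up
  to the factor \<open>N \<bullet> \<xi>\<close>, and differentiating \<open>N \<bullet> D1 \<xi> = 0\<close> and \<open>N \<bullet> D1 f = 0\<close> reduces the
  self-adjointness of the shape operator \<open>S\<close> to the symmetry of second derivatives.  A self-adjoint
  operator whose only eigenvalues are \<open>l1\<close> and \<open>l2\<close> satisfies \<open>S\<^sup>2 = (l1 + l2) S - l1 l2\<close>.  This
  identity gives (i), because the two sides of the pseudosymmetry condition are derivations that
  agree on the form \<open>S\<close>; it also gives \<open>Ric = tr S S - S\<^sup>2 = c S + l1 l2 h\<close> with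
  \<open>c = (k - 1) l1 + (n - k - 1) l2\<close>, so that (ii) holds with the function \<open>1 / c\<^sup>2\<close>.
\<close>

section \<open>Second derivatives\<close>

lemma has_derivative_D1_on_smooth:
  assumes "smooth_on f U" "u \<in> U"
  shows "(f has_derivative D1 f u) (at u)"
proof -
  have "Ck_on (Suc 0) f U"
    using assms(1) unfolding smooth_on_def by blast
  then show ?thesis
    using assms(2) frechet_derivative_works by auto
qed

lemma has_derivative_D2_on_smooth:
  assumes "smooth_on f U" "u \<in> U"
  shows "((\<lambda>w. D1 f w b) has_derivative (\<lambda>a. D2 f u a b)) (at u)"
proof -
  have "Ck_on (Suc (Suc 0)) f U"
    using assms(1) unfolding smooth_on_def by blast
  then have "(\<lambda>w. D1 f w b) differentiable at u"
    using assms(2) by simp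
  then show ?thesis
    by (rule frechet_derivative_works[THEN iffD1])
qed

lemma continuous_on_D2_on_smooth:
  assumes "smooth_on f U"
  shows "continuous_on U (\<lambda>w. D2 f w a b)"
proof -
  have "Ck_on (Suc (Suc 0)) f U"
    using assms(1) unfolding smooth_on_def by blast
  then show ?thesis by simp
qed

text \<open>Linearity of \<open>D1 f w\<close> in the vector holds at every
  \<open>w \<in> U\<close>; since \<open>U\<close> is open, both sides of the identity agree near
  \<open>u\<close>, and uniqueness of the derivative carries the identity over to
  \<open>D2\<close>.\<close>

lemma D2_linear_right:
  assumes "smooth_on f U" "open U" "u \<in> U"
  shows "linear (D2 f u a)"
proof (rule linearI)
  have lin: "linear (D1 f w)" if "w \<in> U" for w
    using has_derivative_D1_on_smooth[OF assms(1) that] has_derivative_linear by blast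
  show "D2 f u a (b + c) = D2 f u a b + D2 f u a c" for b c
  proof -
    have "((\<lambda>w. D1 f w b + D1 f w c) has_derivative (\<lambda>a. D2 f u a b + D2 f u a c)) (at u)"
      by (rule has_derivative_add[OF has_derivative_D2_on_smooth has_derivative_D2_on_smooth, OF assms(1,3,1,3)])
    then have "((\<lambda>w. D1 f w (b + c)) has_derivative (\<lambda>a. D2 f u a b + D2 f u a c)) (at u)"
      by (rule has_derivative_transform_within_open[OF _ assms(2,3)]) (simp add: linear_add[OF lin])
    from fun_cong[OF frechet_derivative_at[OF this], of a] show ?thesis by (rule sym)
  qed
  show "D2 f u a (r *\<^sub>R b) = r *\<^sub>R D2 f u a b" for r b
  proof -
    have "((\<lambda>w. r *\<^sub>R D1 f w b) has_derivative (\<lambda>a. r *\<^sub>R D2 f u a b)) (at u)"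
      by (rule bounded_linear.has_derivative[OF bounded_linear_scaleR_right has_derivative_D2_on_smooth[OF assms(1,3)]])
    then have "((\<lambda>w. D1 f w (r *\<^sub>R b)) has_derivative (\<lambda>a. r *\<^sub>R D2 f u a b)) (at u)"
      by (rule has_derivative_transform_within_open[OF _ assms(2,3)]) (rule linear_scale[OF lin, symmetric])
    from fun_cong[OF frechet_derivative_at[OF this], of a] show ?thesis by (rule sym)
  qed
qed

text \<open>The mean value theorem is applied twice to the second difference over a parallelogram,
  first along \<open>a\<close>, then along \<open>b\<close>. Pairing with \<open>N\<close> makes the
  functions real-valued, so that each application yields an equality.\<close>

lemma mixed_difference_eq_D2:
  fixes f :: "'v::real_normed_vector \<Rightarrow> 'w::real_inner"
  assumes "smooth_on f U" "t > 0"
    and sub: "\<And>r s. \<lbrakk>0 \<le> r; r \<le> t; 0 \<le> s; s \<le> t\<rbrakk> \<Longrightarrow> u + r *\<^sub>R a + s *\<^sub>R b \<in> U"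
  shows "\<exists>r\<in>{0<..<t}. \<exists>s\<in>{0<..<t}.
    N \<bullet> (f (u + t *\<^sub>R a + t *\<^sub>R b) - f (u + t *\<^sub>R a) - f (u + t *\<^sub>R b) + f u) =
    t * t * (N \<bullet> D2 f (u + r *\<^sub>R a + s *\<^sub>R b) b a)"
proof -
  \<comment> \<open>The increment over the side in direction \<open>b\<close>; the second difference
    is \<open>p t - p 0\<close>.\<close>
  define p where "p r = N \<bullet> (f (u + r *\<^sub>R a + t *\<^sub>R b) - f (u + r *\<^sub>R a))" for r
  have dp: "(p has_derivative
      (\<lambda>x. N \<bullet> (D1 f (u + r *\<^sub>R a + t *\<^sub>R b) (x *\<^sub>R a) - D1 f (u + r *\<^sub>R a) (x *\<^sub>R a)))) (at r)"
    if "0 \<le> r" "r \<le> t" for r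
  proof -
    have 1: "u + r *\<^sub>R a + t *\<^sub>R b \<in> U" "u + r *\<^sub>R a \<in> U"
      using sub[of r t] sub[of r 0] that assms(2) by auto
    have "((\<lambda>r. f (u + r *\<^sub>R a + t *\<^sub>R b)) has_derivative
        (\<lambda>x. D1 f (u + r *\<^sub>R a + t *\<^sub>R b) (x *\<^sub>R a))) (at r)"
      by (rule has_derivative_compose[where g = f], auto intro!: derivative_eq_intros)
        (rule has_derivative_D1_on_smooth[OF assms(1) 1(1)])
    moreover have "((\<lambda>r. f (u + r *\<^sub>R a)) has_derivative
        (\<lambda>x. D1 f (u + r *\<^sub>R a) (x *\<^sub>R a))) (at r)"
      by (rule has_derivative_compose[where g = f], auto intro!: derivative_eq_intros)
        (rule has_derivative_D1_on_smooth[OF assms(1) 1(2)])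
    ultimately show ?thesis
      unfolding p_def by (intro has_derivative_inner_right has_derivative_diff)
  qed
  have "\<exists>r\<in>{0<..<t}. p t - p 0 =
      N \<bullet> (D1 f (u + r *\<^sub>R a + t *\<^sub>R b) ((t - 0) *\<^sub>R a) - D1 f (u + r *\<^sub>R a) ((t - 0) *\<^sub>R a))"
    by (rule mvt_simple[OF assms(2) has_derivative_at_withinI[OF dp]])
  then obtain r where r: "r \<in> {0<..<t}"
    and pr: "p t - p 0 =
      N \<bullet> (D1 f (u + r *\<^sub>R a + t *\<^sub>R b) (t *\<^sub>R a) - D1 f (u + r *\<^sub>R a) (t *\<^sub>R a))"
    by auto
  \<comment> \<open>With the intermediate \<open>r\<close> fixed, \<open>p t - p 0\<close> is
    \<open>t\<close> times the increment of \<open>q\<close>.\<close>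
  define q where "q s = N \<bullet> D1 f (u + r *\<^sub>R a + s *\<^sub>R b) a" for s
  have dq: "(q has_derivative (\<lambda>x. N \<bullet> D2 f (u + r *\<^sub>R a + s *\<^sub>R b) (x *\<^sub>R b) a)) (at s)"
    if "0 \<le> s" "s \<le> t" for s
  proof -
    have 1: "u + r *\<^sub>R a + s *\<^sub>R b \<in> U"
      using sub[of r s] that r by auto
    have "((\<lambda>s. D1 f (u + r *\<^sub>R a + s *\<^sub>R b) a) has_derivative
        (\<lambda>x. D2 f (u + r *\<^sub>R a + s *\<^sub>R b) (x *\<^sub>R b) a)) (at s)"
      by (rule has_derivative_compose[where g = "\<lambda>w. D1 f w a"], auto intro!: derivative_eq_intros)
        (rule has_derivative_D2_on_smooth[OF assms(1) 1])
    then show ?thesis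
      unfolding q_def by (intro has_derivative_inner_right)
  qed
  have "\<exists>s\<in>{0<..<t}. q t - q 0 = N \<bullet> D2 f (u + r *\<^sub>R a + s *\<^sub>R b) ((t - 0) *\<^sub>R b) a"
    by (rule mvt_simple[OF assms(2) has_derivative_at_withinI[OF dq]])
  then obtain s where s: "s \<in> {0<..<t}"
    and qs: "q t - q 0 = N \<bullet> D2 f (u + r *\<^sub>R a + s *\<^sub>R b) (t *\<^sub>R b) a"
    by auto
  have U3: "u + r *\<^sub>R a + t *\<^sub>R b \<in> U" "u + r *\<^sub>R a \<in> U" "u + r *\<^sub>R a + s *\<^sub>R b \<in> U"
    using sub[of r t] sub[of r 0] sub[of r s] r s assms(2) by auto
  have lin: "D1 f w (t *\<^sub>R v) = t *\<^sub>R D1 f w v" if "w \<in> U" for w v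
    by (rule linear_scale[OF has_derivative_linear[OF has_derivative_D1_on_smooth[OF assms(1) that]]])
  have lin2: "D2 f (u + r *\<^sub>R a + s *\<^sub>R b) (t *\<^sub>R b) a = t *\<^sub>R D2 f (u + r *\<^sub>R a + s *\<^sub>R b) b a"
    by (rule linear_scale[OF has_derivative_linear[OF has_derivative_D2_on_smooth[OF assms(1) U3(3)]]])
  have "p t - p 0 = t * (q t - q 0)"
    unfolding pr q_def using lin U3 by (simp add: algebra_simps)
  also have "\<dots> = t * t * (N \<bullet> D2 f (u + r *\<^sub>R a + s *\<^sub>R b) b a)"
    unfolding qs lin2 by simp
  finally show ?thesis
    using r s by (intro bexI[of _ r] bexI[of _ s]) (auto simp: p_def inner_diff_right inner_add_right)
qed

text \<open>Schwarz: the second difference does not change when \<open>a\<close> and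
  \<open>b\<close> are exchanged, so \<open>D2\<close> in one order at some point near
  \<open>u\<close> equals \<open>D2\<close> in the other order at another such point; continuity of
  \<open>D2\<close> moves both points to \<open>u\<close>.\<close>

lemma D2_symmetric:
  fixes f :: "'v::real_normed_vector \<Rightarrow> 'w::real_inner"
  assumes "smooth_on f U" "open U" "u \<in> U"
  shows "D2 f u a b = D2 f u b a"
proof -
  have "N \<bullet> D2 f u a b = N \<bullet> D2 f u b a" for N
  proof (rule ccontr)
    assume ne: "N \<bullet> D2 f u a b \<noteq> N \<bullet> D2 f u b a"
    \<comment> \<open>Half the supposed gap: two values within \<open>e\<close> of a common number
      cannot be \<open>2 * e\<close> apart.\<close>
    define e where "e = \<bar>N \<bullet> D2 f u a b - N \<bullet> D2 f u b a\<bar> / 2"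
    have e: "e > 0" using ne by (simp add: e_def)
    have cont: "\<exists>d>0. \<forall>w\<in>U. dist w u < d \<longrightarrow> dist (N \<bullet> D2 f w c c') (N \<bullet> D2 f u c c') < e"
      for c c'
    proof -
      have "continuous_on U (\<lambda>w. N \<bullet> D2 f w c c')"
        by (intro continuous_intros continuous_on_D2_on_smooth[OF assms(1)])
      then show ?thesis
        using assms(3) e unfolding continuous_on_iff by blast
    qed
    obtain d1 where d1: "d1 > 0"
      "\<And>w. w\<in>U \<Longrightarrow> dist w u < d1 \<Longrightarrow> dist (N \<bullet> D2 f w a b) (N \<bullet> D2 f u a b) < e"
      using cont by metis
    obtain d2 where d2: "d2 > 0"
      "\<And>w. w\<in>U \<Longrightarrow> dist w u < d2 \<Longrightarrow> dist (N \<bullet> D2 f w b a) (N \<bullet> D2 f u b a) < e"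
      using cont by metis
    obtain d3 where d3: "d3 > 0" "ball u d3 \<subseteq> U"
      using assms(2,3) open_contains_ball by blast
    define d where "d = min d1 (min d2 d3)"
    \<comment> \<open>The summand 1 keeps \<open>K\<close> positive; with side parameter
      \<open>t = d / (2 * K)\<close> the parallelogram stays within distance \<open>d / 2\<close> of
      \<open>u\<close>.\<close>
    define K where "K = norm a + norm b + 1"
    define t where "t = d / (2 * K)"
    have d: "d > 0" using d1 d2 d3 by (simp add: d_def)
    have den: "K > 0"
      by (simp add: K_def add_nonneg_pos)
    have t: "t > 0" using d den by (simp add: t_def)
    have near: "dist (u + r *\<^sub>R a + s *\<^sub>R b) u < d" if "0 \<le> r" "r \<le> t" "0 \<le> s" "s \<le> t" for r s
    proof -
      have "dist (u + r *\<^sub>R a + s *\<^sub>R b) u = norm (r *\<^sub>R a + s *\<^sub>R b)"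
        by (simp add: dist_norm algebra_simps)
      also have "\<dots> \<le> r * norm a + s * norm b"
        using norm_triangle_ineq[of "r *\<^sub>R a" "s *\<^sub>R b"] that by simp
      also have "\<dots> \<le> t * norm a + t * norm b"
        using that by (intro add_mono mult_right_mono) auto
      also have "\<dots> \<le> t * K"
        using t by (simp add: K_def algebra_simps)
      also have "\<dots> = d / 2"
        using den by (simp add: t_def)
      also have "\<dots> < d" using d by simp
      finally show ?thesis .
    qed
    have inU: "u + r *\<^sub>R a + s *\<^sub>R b \<in> U" if "0 \<le> r" "r \<le> t" "0 \<le> s" "s \<le> t" for r s
      using near[OF that] d3(2) by (auto simp: d_def dist_commute)
    have inU': "u + r *\<^sub>R b + s *\<^sub>R a \<in> U" if "0 \<le> r" "r \<le> t" "0 \<le> s" "s \<le> t" for r s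
      using inU[of s r] that by (simp add: add_ac)
    obtain r s where rs: "r \<in> {0<..<t}" "s \<in> {0<..<t}"
      "N \<bullet> (f (u + t *\<^sub>R a + t *\<^sub>R b) - f (u + t *\<^sub>R a) - f (u + t *\<^sub>R b) + f u) =
      t * t * (N \<bullet> D2 f (u + r *\<^sub>R a + s *\<^sub>R b) b a)"
      using mixed_difference_eq_D2[OF assms(1) t inU] by blast
    obtain r' s' where rs': "r' \<in> {0<..<t}" "s' \<in> {0<..<t}"
      "N \<bullet> (f (u + t *\<^sub>R b + t *\<^sub>R a) - f (u + t *\<^sub>R b) - f (u + t *\<^sub>R a) + f u) =
      t * t * (N \<bullet> D2 f (u + r' *\<^sub>R b + s' *\<^sub>R a) a b)"
      using mixed_difference_eq_D2[OF assms(1) t inU'] by blast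
    have "t * t * (N \<bullet> D2 f (u + r *\<^sub>R a + s *\<^sub>R b) b a) =
        t * t * (N \<bullet> D2 f (u + r' *\<^sub>R b + s' *\<^sub>R a) a b)"
      unfolding rs(3)[symmetric] rs'(3)[symmetric] by (simp add: algebra_simps)
    then have eq: "N \<bullet> D2 f (u + r *\<^sub>R a + s *\<^sub>R b) b a = N \<bullet> D2 f (u + s' *\<^sub>R a + r' *\<^sub>R b) a b"
      using t by (simp add: add_ac)
    have "dist (N \<bullet> D2 f (u + r *\<^sub>R a + s *\<^sub>R b) b a) (N \<bullet> D2 f u b a) < e"
      using rs near[of r s] by (intro d2(2) inU) (auto simp: d_def)
    moreover have "dist (N \<bullet> D2 f (u + s' *\<^sub>R a + r' *\<^sub>R b) a b) (N \<bullet> D2 f u a b) < e"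
      using rs' near[of s' r'] by (intro d1(2) inU) (auto simp: d_def)
    ultimately have "dist (N \<bullet> D2 f u b a) (N \<bullet> D2 f u a b) < 2 * e"
      unfolding eq
      using dist_triangle3[of "N \<bullet> D2 f u b a" "N \<bullet> D2 f u a b" "N \<bullet> D2 f (u + s' *\<^sub>R a + r' *\<^sub>R b) a b"]
      by linarith
    then show False
      by (simp only: e_def dist_real_def) (simp add: abs_minus_commute)
  qed
  then show ?thesis
    by (metis inner_commute vector_eq_ldot)
qed

section \<open>Conormal field of a parametrization\<close>

text \<open>The linear map whose matrix has the columns of \<open>frame_det\<close>: the coordinate
  \<open>None\<close> is the coefficient of \<open>y\<close>. Nonvanishing of the determinant
  thereby becomes injectivity.\<close>

definition frame_map ::
  "(real^'n::finite \<Rightarrow> real^('n option)) \<Rightarrow> real^('n option) \<Rightarrow> real^('n option) \<Rightarrow> real^('n option)"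
  where "frame_map L y v = v $ None *\<^sub>R y + L (\<chi> i. v $ Some i)"

lemma linear_frame_map:
  fixes L :: "real^'n::finite \<Rightarrow> real^('n option)"
  assumes "linear L"
  shows "linear (frame_map L y)"
proof (rule linearI)
  fix v w :: "real^('n option)" and r :: real
  have "(\<chi> i. (v + w) $ Some i) = (\<chi> i. v $ Some i) + (\<chi> i. w $ Some i)"
    by (simp add: vec_eq_iff)
  then show "frame_map L y (v + w) = frame_map L y v + frame_map L y w"
    by (simp add: frame_map_def linear_add[OF assms] algebra_simps)
  have "(\<chi> i. (r *\<^sub>R v) $ Some i) = r *\<^sub>R (\<chi> i. v $ Some i)"
    by (simp add: vec_eq_iff)
  then show "frame_map L y (r *\<^sub>R v) = r *\<^sub>R frame_map L y v"
    by (simp add: frame_map_def linear_scale[OF assms] algebra_simps)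
qed

lemma frame_det_eq_det_frame_map:
  fixes f :: "real^'n::finite \<Rightarrow> real^('n option)"
  assumes "linear (D1 f w)"
  shows "frame_det f y w = det (matrix (frame_map (D1 f w) y))"
proof -
  have "frame_map (D1 f w) y (axis c 1) = (case c of None \<Rightarrow> y | Some i \<Rightarrow> D1 f w (axis i 1))" for c
  proof (cases c)
    case None
    have "(\<chi> i. (axis None 1 :: real^('n option)) $ Some i) = (0 :: real^'n)"
      by (simp add: vec_eq_iff axis_def)
    then show ?thesis
      using None linear_0[OF assms] by (simp add: frame_map_def)
  next
    case (Some j)
    have "(\<chi> i. (axis (Some j) 1 :: real^('n option)) $ Some i) = (axis j 1 :: real^'n)"
      by (auto simp add: vec_eq_iff axis_def)
    then show ?thesis
      using Some by (simp add: frame_map_def axis_def)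
  qed
  then show ?thesis
    by (simp add: frame_det_def matrix_def)
qed

text \<open>A kernel vector of \<open>frame_map\<close> has zero coefficient at \<open>y\<close>, as
  otherwise \<open>y\<close> would be tangent; injectivity of the differential removes the
  rest.\<close>

lemma frame_det_nonzero:
  assumes "linear (D1 f w)" "inj (D1 f w)" "y \<notin> range (D1 f w)"
  shows "frame_det f y w \<noteq> 0"
proof -
  have "v = 0" if "frame_map (D1 f w) y v = 0" for v
  proof -
    have eq: "v $ None *\<^sub>R y = D1 f w (- (\<chi> i. v $ Some i))"
      using that by (simp add: frame_map_def linear_neg[OF assms(1)] eq_neg_iff_add_eq_0)
    have "v $ None = 0"
    proof (rule ccontr)
      assume n: "v $ None \<noteq> 0"
      have "y = (1 / v $ None) *\<^sub>R (v $ None *\<^sub>R y)"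
        using n by simp
      also have "\<dots> = D1 f w ((1 / v $ None) *\<^sub>R - (\<chi> i. v $ Some i))"
        unfolding eq by (rule linear_scale[OF assms(1), symmetric])
      finally show False
        using assms(3) by blast
    qed
    moreover from this have "D1 f w (\<chi> i. v $ Some i) = 0"
      using that by (simp add: frame_map_def)
    then have "(\<chi> i. v $ Some i) = 0"
      using assms(1,2) by (simp add: linear_inj_iff_eq_0)
    then have "v $ Some i = 0" for i
      by (metis vec_lambda_beta zero_index)
    ultimately have "v $ c = 0" for c
      by (cases c) auto
    then show ?thesis
      by (simp add: vec_eq_iff)
  qed
  then have "inj (frame_map (D1 f w) y)"
    using linear_inj_iff_eq_0[OF linear_frame_map[OF assms(1)]] by blast
  then show ?thesis
    using det_nz_iff_inj[OF linear_frame_map[OF assms(1)]] frame_det_eq_det_frame_map[OF assms(1)]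
    by metis
qed

text \<open>Transposition puts the frame vectors into rows, the shape to which the rules on
  linearity in one row and on identical rows apply.\<close>

lemma frame_det_eq_det_rows:
  "frame_det f y w = det (\<chi> c. if c = None then y else D1 f w (axis (the c) 1))"
proof -
  have "frame_det f y w = det (transpose (\<chi> c. if c = None then y else D1 f w (axis (the c) 1)))"
    unfolding frame_det_def transpose_def
    by (intro arg_cong[where f = det]) (auto simp: vec_eq_iff split: option.split)
  then show ?thesis by simp
qed

lemma linear_frame_det: "linear (\<lambda>y. frame_det f y w)"
proof (rule linearI)
  show "frame_det f (y + z) w = frame_det f y w + frame_det f z w" for y z
    unfolding frame_det_eq_det_rows by (rule det_row_add)
  show "frame_det f (r *\<^sub>R y) w = r *\<^sub>R frame_det f y w" for r y
    unfolding frame_det_eq_det_rows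
    using det_row_mul[of None r "\<lambda>_. y" "\<lambda>c. D1 f w (axis (the c) 1)"]
    by (simp only: scalar_mult_eq_scaleR real_scaleR_def)
qed

text \<open>For a coordinate vector two rows coincide; linearity in the completing vector extends
  this to all tangent vectors.\<close>

lemma frame_det_tangent:
  assumes "linear (D1 f w)"
  shows "frame_det f (D1 f w a) w = 0"
proof -
  have 0: "frame_det f (D1 f w (axis i 1)) w = 0" for i
    unfolding frame_det_eq_det_rows
    by (rule det_identical_rows[of None "Some i"]) (auto simp: row_def vec_eq_iff)
  have a: "a = (\<Sum>i\<in>UNIV. a $ i *\<^sub>R axis i 1)"
    using basis_expansion[of a] by (simp add: scalar_mult_eq_scaleR)
  have "D1 f w a = (\<Sum>i\<in>UNIV. a $ i *\<^sub>R D1 f w (axis i 1))"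
    by (subst a) (simp add: linear_sum[OF assms] linear_scale[OF assms])
  then show ?thesis
    using 0 by (simp add: linear_sum[OF linear_frame_det] linear_scale[OF linear_frame_det])
qed

definition conormal :: "(real^'n::finite \<Rightarrow> real^('n option)) \<Rightarrow> real^'n \<Rightarrow> real^('n option)" where
  "conormal f w = (\<Sum>r\<in>UNIV. frame_det f (axis r 1) w *\<^sub>R axis r 1)"

lemma inner_conormal: "conormal f w \<bullet> y = frame_det f y w"
proof -
  have y: "y = (\<Sum>r\<in>UNIV. y $ r *\<^sub>R axis r 1)"
    using basis_expansion[of y] by (simp add: scalar_mult_eq_scaleR)
  have "frame_det f y w = (\<Sum>r\<in>UNIV. y $ r * frame_det f (axis r 1) w)"
    by (subst y) (simp add: linear_sum[OF linear_frame_det] linear_scale[OF linear_frame_det])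
  also have "\<dots> = conormal f w \<bullet> y"
    by (simp add: conormal_def inner_sum_left inner_axis' mult.commute)
  finally show ?thesis by simp
qed

text \<open>The coordinates of the conormal are determinants, hence polynomials in the components of
  the vectors \<open>D1 f w (axis i 1)\<close>, which are differentiable because \<open>f\<close>
  has second derivatives.\<close>

lemma conormal_differentiable:
  assumes "smooth_on f U" "u \<in> U"
  shows "conormal f differentiable (at u)"
proof -
  have entry: "(\<lambda>w. (case c of None \<Rightarrow> y | Some i \<Rightarrow> D1 f w (axis i 1)) $ r) differentiable (at u)"
    for c :: "'a option" and y r
  proof (cases c)
    case (Some i)
    have "((\<lambda>w. D1 f w (axis i 1) $ r) has_derivative (\<lambda>a. D2 f u a (axis i 1) $ r)) (at u)"
      by (rule bounded_linear.has_derivative[OF bounded_linear_vec_nth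
            has_derivative_D2_on_smooth[OF assms]])
    then show ?thesis
      using Some by (auto simp: differentiable_def)
  qed auto
  have prod: "(\<lambda>w. \<Prod>i\<in>I. g i w) differentiable (at u)"
    if "\<And>i. g i differentiable (at u)" for g :: "'a option \<Rightarrow> real^'a \<Rightarrow> real" and I
    by (rule differentiableI[OF has_derivative_prod])
      (rule that[unfolded frechet_derivative_works])
  have "(\<lambda>w. frame_det f y w) differentiable (at u)" for y
    unfolding frame_det_def det_def vec_lambda_beta
    by (rule differentiable_sum, simp, rule ballI, rule differentiable_mult, rule differentiable_const,
        rule prod, rule entry)
  then show ?thesis
    unfolding conormal_def[abs_def]
    by (intro differentiable_sum differentiable_scaleR) auto
qed

text \<open>The tangent space lies in the hyperplane orthogonal to the conormal, and both have
  dimension n; the transversal \<open>z\<close> guarantees that the conormal is nonzero.\<close>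

lemma orthogonal_conormal_iff:
  assumes "linear (D1 f u)" "inj (D1 f u)" "z \<notin> range (D1 f u)"
  shows "conormal f u \<bullet> y = 0 \<longleftrightarrow> y \<in> range (D1 f u)"
proof -
  have ne: "conormal f u \<noteq> 0"
    using frame_det_nonzero[OF assms] inner_conormal[of f u z] by auto
  have "dim (range (D1 f u)) = CARD('a)"
    using dim_image_eq[OF assms(1), of UNIV] assms(2) by simp
  moreover have "dim {y. conormal f u \<bullet> y = 0} = CARD('a)"
    using dim_hyperplane[OF ne] by simp
  moreover have "range (D1 f u) \<subseteq> {y. conormal f u \<bullet> y = 0}"
    using frame_det_tangent[OF assms(1)] by (auto simp: inner_conormal)
  ultimately have "range (D1 f u) = {y. conormal f u \<bullet> y = 0}"
    using subspace_dim_equal[OF linear_subspace_image[OF assms(1) subspace_UNIV] subspace_hyperplane]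
    by (metis order_refl)
  then show ?thesis by auto
qed

text \<open>Pairing the Gauss formula with the conormal kills precisely the tangential part and
  leaves a linear equation for the coefficient of \<open>z\<close>.\<close>

lemma affine_form_eq_conormal:
  assumes "linear (D1 f u)" "inj (D1 f u)" "z \<notin> range (D1 f u)"
  shows "affine_form f z u a b = (conormal f u \<bullet> D2 f u a b) / (conormal f u \<bullet> z)"
  unfolding affine_form_def
proof (rule the_equality)
  note iff = orthogonal_conormal_iff[OF assms]
  have ne: "conormal f u \<bullet> z \<noteq> 0"
    using iff assms(3) by blast
  show "D2 f u a b - (conormal f u \<bullet> D2 f u a b / (conormal f u \<bullet> z)) *\<^sub>R z \<in> range (D1 f u)"
    using ne by (subst iff[symmetric]) (simp add: inner_diff_right)
  show "c = conormal f u \<bullet> D2 f u a b / (conormal f u \<bullet> z)"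
    if "D2 f u a b - c *\<^sub>R z \<in> range (D1 f u)" for c
    using that ne by (subst (asm) iff[symmetric]) (simp add: inner_diff_right field_simps)
qed

text \<open>Both \<open>conormal f w \<bullet> D1 \<eta> w b\<close> and \<open>conormal f w \<bullet> D1 f w c\<close> vanish identically in \<open>w\<close>, so
  their derivatives at \<open>u\<close> vanish, and the terms containing the derivative of the conormal agree.\<close>

lemma conormal_inner_D2:
  assumes "smooth_on f U" "smooth_on \<eta> U" "open U" "u \<in> U"
    and tangent: "\<And>w a. w \<in> U \<Longrightarrow> D1 \<eta> w a \<in> range (D1 f w)"
    and eq: "D1 \<eta> u b = D1 f u c"
  shows "conormal f u \<bullet> D2 \<eta> u a b = conormal f u \<bullet> D2 f u a c"
proof -
  obtain C where C: "(conormal f has_derivative C) (at u)"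
    using conormal_differentiable[OF assms(1,4)] by (auto simp: differentiable_def)
  have lin: "linear (D1 f w)" if "w \<in> U" for w
    by (rule has_derivative_linear[OF has_derivative_D1_on_smooth[OF assms(1) that]])
  have zero: "conormal f w \<bullet> y = 0" if "w \<in> U" "y \<in> range (D1 f w)" for w y
    using frame_det_tangent[OF lin[OF that(1)]] that(2) by (auto simp: inner_conormal)
  have const: "conormal f u \<bullet> g' a + C a \<bullet> g u = 0"
    if "(g has_derivative g') (at u)" "\<And>w. w \<in> U \<Longrightarrow> conormal f w \<bullet> g w = 0" for g g'
  proof -
    have "((\<lambda>w. conormal f w \<bullet> g w) has_derivative (\<lambda>a. conormal f u \<bullet> g' a + C a \<bullet> g u)) (at u)"
      by (rule has_derivative_inner[OF C that(1)])
    moreover have "((\<lambda>w. conormal f w \<bullet> g w) has_derivative (\<lambda>a. 0)) (at u)"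
      by (rule has_derivative_transform_within_open[OF has_derivative_const assms(3,4)])
        (simp add: that(2))
    ultimately show ?thesis
      by (rule fun_cong[OF has_derivative_unique])
  qed
  have "conormal f u \<bullet> D2 \<eta> u a b + C a \<bullet> D1 \<eta> u b = 0"
    by (rule const[OF has_derivative_D2_on_smooth[OF assms(2,4)]]) (simp add: zero tangent)
  moreover have "conormal f u \<bullet> D2 f u a c + C a \<bullet> D1 f u c = 0"
    by (rule const[OF has_derivative_D2_on_smooth[OF assms(1,4)]]) (simp add: zero)
  ultimately show ?thesis
    using eq by simp
qed

section \<open>Orthonormal frames of the Blaschke metric\<close>

text \<open>Pairing a linear relation with one of its vectors isolates the coefficient of that
  vector.\<close>

lemma orthonormal_independent:
  fixes g :: "'v::real_vector \<Rightarrow> 'v \<Rightarrow> real"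
  assumes "\<And>y. linear (\<lambda>x. g x y)" "\<And>x y. \<lbrakk>x \<in> B; y \<in> B\<rbrakk> \<Longrightarrow> g x y = (if x = y then 1 else 0)"
  shows "independent B"
  unfolding independent_explicit_module
proof (intro allI impI)
  fix S c v
  assume S: "finite S" "S \<subseteq> B" "(\<Sum>x\<in>S. c x *\<^sub>R x) = 0" "v \<in> S"
  have "0 = g (\<Sum>x\<in>S. c x *\<^sub>R x) v"
    using S(3) linear_0[OF assms(1)] by simp
  also have "\<dots> = (\<Sum>x\<in>S. c x * g x v)"
    by (simp add: linear_sum[OF assms(1)] linear_scale[OF assms(1)])
  also have "\<dots> = (\<Sum>x\<in>S. if x = v then c x else 0)"
  proof (rule sum.cong)
    fix x assume "x \<in> S"
    then show "c x * g x v = (if x = v then c x else 0)"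
      using assms(2)[of x v] S(4) subsetD[OF S(2)] by auto
  qed simp
  also have "\<dots> = c v"
    using S by simp
  finally show "c v = 0" by simp
qed

text \<open>An orthonormal set of greatest cardinality spans, since otherwise a Gram-Schmidt step
  would enlarge it.\<close>

lemma orthonormal_basis_exists:
  fixes g :: "'v::euclidean_space \<Rightarrow> 'v \<Rightarrow> real"
  assumes lin: "\<And>y. linear (\<lambda>x. g x y)" and sym: "\<And>x y. g x y = g y x"
    and pos: "\<And>x. x \<noteq> 0 \<Longrightarrow> g x x > 0"
  obtains B where "finite B" "span B = UNIV"
    "\<And>x y. \<lbrakk>x \<in> B; y \<in> B\<rbrakk> \<Longrightarrow> g x y = (if x = y then 1 else 0)"
proof -
  define on where "on B \<longleftrightarrow> (\<forall>x\<in>B. \<forall>y\<in>B. g x y = (if x = y then 1 else 0))" for B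
  have card: "finite B \<and> card B \<le> DIM('v)" if "on B" for B
  proof -
    have "independent B"
      by (rule orthonormal_independent[of g, OF lin]) (use that in \<open>auto simp: on_def\<close>)
    then show ?thesis by (rule independent_bound)
  qed
  have "on {}" by (simp add: on_def)
  \<comment> \<open>A greatest cardinality exists because orthonormal sets are independent, hence
    bounded in size by the dimension.\<close>
  then obtain B where B: "on B" "\<And>C. on C \<Longrightarrow> card C \<le> card B"
    using ex_has_greatest_nat[of on "{}" card "Suc DIM('v)"] card by (auto simp: less_Suc_eq_le)
  have fin: "finite B" using card B by blast
  have "span B = UNIV"
  proof (rule ccontr)
    assume "span B \<noteq> UNIV"
    then obtain x where x: "x \<notin> span B" by auto
    \<comment> \<open>\<open>x\<close> minus its \<open>g\<close>-orthogonal projection to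
      \<open>span B\<close>.\<close>
    define z where "z = x - (\<Sum>b\<in>B. g x b *\<^sub>R b)"
    have "z \<noteq> 0"
    proof
      assume "z = 0"
      then have "x = (\<Sum>b\<in>B. g x b *\<^sub>R b)" by (simp add: z_def)
      also have "\<dots> \<in> span B" by (intro span_sum span_scale span_base)
      finally show False using x by simp
    qed
    then have z: "g z z > 0" by (rule pos)
    have zb: "g z b = 0" if "b \<in> B" for b
    proof -
      have "(\<Sum>c\<in>B. g x c * g c b) = (\<Sum>c\<in>B. if c = b then g x c else 0)"
        using B(1) that by (intro sum.cong) (auto simp: on_def)
      also have "\<dots> = g x b" using that fin by simp
      finally show ?thesis
        by (simp add: z_def linear_diff[OF lin] linear_sum[OF lin] linear_scale[OF lin])
    qed
    define y where "y = (1 / sqrt (g z z)) *\<^sub>R z"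
    have yl: "g y b = (1 / sqrt (g z z)) * g z b" for b
      by (simp add: y_def linear_scale[OF lin])
    have yb: "g y b = 0" "g b y = 0" if "b \<in> B" for b
      using yl zb[OF that] sym[of b y] by simp_all
    have "g y y = (1 / sqrt (g z z)) * ((1 / sqrt (g z z)) * g z z)"
      using yl[of y] yl[of z] sym[of z y] by simp
    then have yy: "g y y = 1"
      using z by (simp add: real_div_sqrt field_simps)
    have "y \<notin> B" using yb yy by force
    moreover have "on (insert y B)"
      using B(1) yb yy \<open>y \<notin> B\<close> by (auto simp: on_def)
    ultimately show False
      using B(2)[of "insert y B"] fin by simp
  qed
  then show ?thesis
    using that fin B(1) by (auto simp: on_def)
qed

text \<open>\<open>S\<close> sends the standard basis to a \<open>g\<close>-orthonormal basis
  indexed by \<open>'n\<close>. It turns the inner product into \<open>g\<close>, so it is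
  injective, and by equality of dimensions bijective.\<close>

lemma orthonormal_frame_exists:
  fixes g :: "real^'n::finite \<Rightarrow> real^'n \<Rightarrow> real"
  assumes lin: "\<And>y. linear (\<lambda>x. g x y)" and sym: "\<And>x y. g x y = g y x"
    and pos: "\<And>x. x \<noteq> 0 \<Longrightarrow> g x x > 0"
  obtains S :: "real^'n \<Rightarrow> real^'n" where "linear S" "bij S" "\<And>a b. g (S a) (S b) = a \<bullet> b"
proof -
  obtain B where B: "finite B" "span B = UNIV"
    "\<And>x y. \<lbrakk>x \<in> B; y \<in> B\<rbrakk> \<Longrightarrow> g x y = (if x = y then 1 else 0)"
    using orthonormal_basis_exists[OF assms] by blast
  have "card B = CARD('n)"
    using orthonormal_independent[OF lin B(3)] B(2) dim_span_eq_card_independent[of B] by simp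
  then obtain e :: "'n \<Rightarrow> real^'n" where e: "bij_betw e UNIV B"
    using B(1) finite_same_card_bij[of "UNIV :: 'n set" B] by auto
  define S where "S a = (\<Sum>i\<in>UNIV. a $ i *\<^sub>R e i)" for a :: "real^'n"
  have "linear S"
    by (rule linearI) (simp_all add: S_def algebra_simps sum.distrib scaleR_sum_right)
  have ee: "g (e i) (e j) = (if i = j then 1 else 0)" for i j
    using e B(3)[of "e i" "e j"] by (auto simp: bij_betw_def inj_eq)
  have SS: "g (S a) (S b) = a \<bullet> b" for a b
  proof -
    have "g (e i) (S b) = b $ i" for i
    proof -
      have "g (S b) (e i) = (\<Sum>j\<in>UNIV. b $ j * g (e j) (e i))"
        by (simp add: S_def linear_sum[OF lin] linear_scale[OF lin])
      also have "\<dots> = b $ i"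
        by (simp add: ee if_distrib cong: if_cong)
      finally show ?thesis using sym by metis
    qed
    then show ?thesis
      by (simp add: S_def[of a] linear_sum[OF lin] linear_scale[OF lin] inner_vec_def)
  qed
  have "inj S"
  proof (rule linear_injective_0[OF \<open>linear S\<close>, THEN iffD2], intro allI impI)
    fix a assume "S a = 0"
    then have "a \<bullet> a = 0" using SS[of a a] linear_0[OF lin] by simp
    then show "a = 0" by simp
  qed
  then have "bij S"
    using linear_inj_imp_surj[OF \<open>linear S\<close>] by (simp add: bij_def)
  then show ?thesis
    using that \<open>linear S\<close> SS by blast
qed

text \<open>Linear coordinates on the tangent space \<open>V\<close> in which the metric \<open>h\<close> is the standard inner product
  and the operator \<open>T\<close> is the symmetric operator \<open>A\<close>.\<close>

locale adapted_frame =
  fixes \<phi> :: "real^'n::finite \<Rightarrow> real^('n option)" and A :: "real^'n \<Rightarrow> real^'n"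
    and V :: "(real^('n option)) set" and h :: "real^('n option) \<Rightarrow> real^('n option) \<Rightarrow> real"
    and T :: "real^('n option) \<Rightarrow> real^('n option)"
  assumes linear_frame: "linear \<phi>" and inj_frame: "inj \<phi>" and range_frame: "range \<phi> = V"
    and metric_frame: "h (\<phi> a) (\<phi> b) = a \<bullet> b"
    and operator_frame: "T (\<phi> a) = \<phi> (A a)"
    and linear_A: "linear A" and A_symmetric: "A a \<bullet> b = a \<bullet> A b"

text \<open>Metric and shape operator are pulled back to parameter space along the differential
  \<open>L\<close>; composing \<open>L\<close> with an orthonormal frame \<open>S\<close> of the
  pulled-back metric gives the coordinates. Symmetry of \<open>A\<close> comes from the
  self-adjointness \<open>Kg\<close>.\<close>

lemma adapted_frame_exists:
  fixes F \<xi> :: "'a \<Rightarrow> real^('n::finite option)"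
  assumes "hypersurface M F" "affine_normal M F \<xi>" "locally_strongly_convex M F \<xi>" "x \<in> topspace M"
  obtains \<phi> A where
    "adapted_frame \<phi> A (tangent_space M F x) (blaschke_metric M F \<xi> x) (shape_operator M F \<xi> x)"
proof -
  obtain \<psi> u where pa: "param_at M F x = (\<psi>, u)"
    by (cases "param_at M F x") auto
  \<comment> \<open>\<open>param_at\<close> is a choice, so a local parametrization around
    \<open>x\<close> has to be exhibited before the chosen one can be used.\<close>
  have "\<exists>p. case p of (\<psi>, u) \<Rightarrow> \<exists>U. local_param M F U \<psi> \<and> u \<in> U \<and> \<psi> u = x"
    using assms(1,4) unfolding hypersurface_def by fastforce
  from someI_ex[OF this] pa obtain U where U: "local_param M F U \<psi>" "u \<in> U" and x: "\<psi> u = x"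
    unfolding param_at_def by auto
  define f where "f = F \<circ> \<psi>"
  define \<eta> where "\<eta> = \<xi> \<circ> \<psi>"
  define L where "L = D1 f u"
  define g where "g a b = affine_form f (\<xi> x) u a b" for a b
  have oU: "open U" and sf: "smooth_on f U" and injL: "inj L"
    using U by (auto simp: local_param_def f_def L_def)
  have s\<eta>: "smooth_on \<eta> U" and tr: "\<xi> x \<notin> range L"
    and tan: "\<And>w a. w \<in> U \<Longrightarrow> D1 \<eta> w a \<in> range (D1 f w)"
    using assms(2)[unfolded affine_normal_def, rule_format, OF U(1)] U(2) x
    unfolding f_def \<eta>_def L_def by blast+
  have linL: "linear L"
    unfolding L_def by (rule has_derivative_linear[OF has_derivative_D1_on_smooth[OF sf U(2)]])
  have lin\<eta>: "linear (D1 \<eta> u)"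
    by (rule has_derivative_linear[OF has_derivative_D1_on_smooth[OF s\<eta> U(2)]])
  have g: "g a b = (conormal f u \<bullet> D2 f u a b) / (conormal f u \<bullet> \<xi> x)" for a b
    unfolding g_def by (rule affine_form_eq_conormal) (use linL injL tr in \<open>simp_all add: L_def\<close>)
  \<comment> \<open>The shape operator in parameter space; derivatives of the affine normal are
    tangent, so the inverse of \<open>L\<close> applies to them.\<close>
  define K where "K a = inv L (- D1 \<eta> u a)" for a
  have LK: "L (K a) = - D1 \<eta> u a" for a
  proof -
    obtain c where "D1 \<eta> u a = L c" using tan[OF U(2)] by (auto simp: L_def)
    then have "- D1 \<eta> u a \<in> range L" by (simp add: linear_neg[OF linL, symmetric])
    then show ?thesis by (simp add: K_def f_inv_into_f)
  qed
  have linK: "linear K"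
  proof (rule linearI)
    show "K (a + b) = K a + K b" for a b
      by (rule injD[OF injL]) (simp add: LK linear_add[OF linL] linear_add[OF lin\<eta>])
    show "K (r *\<^sub>R a) = r *\<^sub>R K a" for r a
      by (rule injD[OF injL]) (simp add: LK linear_scale[OF linL] linear_scale[OF lin\<eta>])
  qed
  have ling: "linear (\<lambda>a. g a b)" for b
  proof -
    have l: "linear (\<lambda>a. D2 f u a b)"
      by (rule has_derivative_linear[OF has_derivative_D2_on_smooth[OF sf U(2)]])
    show ?thesis
      by (rule linearI)
        (simp_all add: g linear_add[OF l] linear_scale[OF l] inner_add_right add_divide_distrib)
  qed
  have symg: "g a b = g b a" for a b
    by (simp add: g D2_symmetric[OF sf oU U(2), of a b])
  have Kg: "g (K a) b = g a (K b)" for a b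
  proof -
    \<comment> \<open>By the Weingarten formula the derivative of \<open>\<eta>\<close> along
      \<open>b\<close> is that of \<open>f\<close> along \<open>- K b\<close>, which is the
      hypothesis of \<open>conormal_inner_D2\<close>.\<close>
    have *: "conormal f u \<bullet> D2 \<eta> u a b = - (conormal f u \<bullet> D2 f u a (K b))" for a b
    proof -
      have "D1 \<eta> u b = D1 f u (- K b)"
        using LK[of b] linear_neg[OF linL] by (simp add: L_def)
      then have "conormal f u \<bullet> D2 \<eta> u a b = conormal f u \<bullet> D2 f u a (- K b)"
        using conormal_inner_D2[OF sf s\<eta> oU U(2) tan] by blast
      then show ?thesis
        by (simp add: linear_neg[OF D2_linear_right[OF sf oU U(2)]])
    qed
    \<comment> \<open>By \<open>*\<close> both sides are, up to the same factor, the conormal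
      component of \<open>D2 \<eta>\<close>, which is symmetric in \<open>a\<close> and
      \<open>b\<close>.\<close>
    have "g a (K b) = g b (K a)"
      using *[of a b] *[of b a] D2_symmetric[OF s\<eta> oU U(2), of a b] by (simp add: g)
    then show ?thesis using symg by metis
  qed
  have V: "tangent_space M F x = range L"
    by (simp add: tangent_space_def pa f_def L_def)
  have h: "blaschke_metric M F \<xi> x (L a) (L b) = g a b" for a b
    using injL by (simp add: blaschke_metric_def pa g_def f_def L_def)
  have T: "shape_operator M F \<xi> x (L a) = L (K a)" for a
    using injL LK by (simp add: shape_operator_def pa f_def L_def \<eta>_def)
  have pos: "g a a > 0" if "a \<noteq> 0" for a
  proof -
    have "L a \<noteq> 0" using that linL injL by (auto simp: linear_inj_iff_eq_0)
    then have "blaschke_metric M F \<xi> x (L a) (L a) > 0"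
      using assms(3,4) V unfolding locally_strongly_convex_def by blast
    then show ?thesis by (simp add: h)
  qed
  obtain S :: "real^'n \<Rightarrow> real^'n" where S: "linear S" "bij S" "\<And>a b. g (S a) (S b) = a \<bullet> b"
    by (rule orthonormal_frame_exists[of g, OF ling symg pos], assumption, rule that)
  \<comment> \<open>\<open>K\<close> read in the orthonormal coordinates given by
    \<open>S\<close>.\<close>
  define A where "A a = inv S (K (S a))" for a
  have SA: "S (A a) = K (S a)" for a
    using S(2) by (simp add: A_def bij_is_surj surj_f_inv_f)
  have injS: "inj S" using S(2) by (rule bij_is_inj)
  have "adapted_frame (L \<circ> S) A (tangent_space M F x) (blaschke_metric M F \<xi> x)
      (shape_operator M F \<xi> x)"
  proof (rule adapted_frame.intro)
    show "linear (L \<circ> S)" by (rule linear_compose[OF S(1) linL])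
    show "inj (L \<circ> S)" by (rule inj_compose[OF injL injS])
    show "range (L \<circ> S) = tangent_space M F x"
      unfolding V image_comp[symmetric] using S(2) by (simp add: bij_is_surj)
    show "blaschke_metric M F \<xi> x ((L \<circ> S) a) ((L \<circ> S) b) = a \<bullet> b" for a b
      by (simp add: h S(3))
    show "shape_operator M F \<xi> x ((L \<circ> S) a) = (L \<circ> S) (A a)" for a
      by (simp add: T SA)
    show "linear A"
    proof (rule linearI)
      show "A (a + b) = A a + A b" for a b
        by (rule injD[OF injS]) (simp add: SA linear_add[OF S(1)] linear_add[OF linK])
      show "A (r *\<^sub>R a) = r *\<^sub>R A a" for r a
        by (rule injD[OF injS]) (simp add: SA linear_scale[OF S(1)] linear_scale[OF linK])
    qed
    show "A a \<bullet> b = a \<bullet> A b" for a b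
      using Kg[of "S a" "S b"] by (simp only: S(3)[symmetric] SA)
  qed
  then show ?thesis by (rule that)
qed

section \<open>Symmetric operators with two eigenvalues\<close>

text \<open>For small \<open>t\<close> of sign opposite to \<open>\<beta>\<close> the linear term
  would dominate and make the value negative; \<open>t = - \<beta> / c\<close> is small
  enough.\<close>

lemma nonneg_quadratic_linear_part_zero:
  fixes \<beta> \<gamma> :: real
  assumes "\<And>t. 2 * t * \<beta> + t * t * \<gamma> \<ge> 0"
  shows "\<beta> = 0"
proof (rule ccontr)
  assume "\<beta> \<noteq> 0"
  define c where "c = \<bar>\<gamma>\<bar> + 1"
  have c: "c > 0" "\<gamma> < c" by (auto simp: c_def)
  have "c * c * (2 * (- \<beta> / c) * \<beta> + (- \<beta> / c) * (- \<beta> / c) * \<gamma>) = \<beta> * \<beta> * (\<gamma> - 2 * c)"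
    using c(1) by (simp add: field_simps)
  moreover have "\<beta> * \<beta> * (\<gamma> - 2 * c) < 0"
    using \<open>\<beta> \<noteq> 0\<close> c by (intro mult_pos_neg) (auto simp: zero_less_mult_iff)
  moreover have "c * c * (2 * (- \<beta> / c) * \<beta> + (- \<beta> / c) * (- \<beta> / c) * \<gamma>) \<ge> 0"
    using c(1) by (intro mult_nonneg_nonneg assms) auto
  ultimately show False by linarith
qed

text \<open>The eigenvector minimises the Rayleigh quotient.\<close>

lemma symmetric_eigenvector_exists:
  fixes A :: "'v::euclidean_space \<Rightarrow> 'v"
  assumes "linear A" and sym: "\<And>a b. A a \<bullet> b = a \<bullet> A b"
    and "subspace W" and inv: "\<And>w. w \<in> W \<Longrightarrow> A w \<in> W" and "W \<noteq> {0}"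
  obtains v l where "v \<in> W" "v \<noteq> 0" "A v = l *\<^sub>R v"
proof -
  obtain w where w: "w \<in> W" "w \<noteq> 0"
    using assms(3,5) subspace_0 by blast
  have "(1 / norm w) *\<^sub>R w \<in> W \<inter> sphere 0 1"
    using w assms(3) by (simp add: subspace_scale)
  then have ne: "W \<inter> sphere 0 1 \<noteq> {}" by blast
  have "compact (W \<inter> sphere 0 1)"
    by (intro closed_Int_compact closed_subspace assms(3) compact_sphere)
  moreover have "continuous_on (W \<inter> sphere 0 1) (\<lambda>x. x \<bullet> A x)"
    using assms(1) by (intro continuous_on_inner continuous_on_id linear_continuous_on)
      (simp add: linear_conv_bounded_linear)
  ultimately obtain v where v: "v \<in> W \<inter> sphere 0 1"
    and min: "\<And>x. x \<in> W \<inter> sphere 0 1 \<Longrightarrow> v \<bullet> A v \<le> x \<bullet> A x"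
    using continuous_attains_inf[OF _ ne] by blast
  define m where "m = v \<bullet> A v"
  have vW: "v \<in> W" and vv: "v \<bullet> v = 1"
    using v by (auto simp: norm_eq_1)
  have ge: "x \<bullet> A x \<ge> m * (x \<bullet> x)" if "x \<in> W" for x
  proof (cases "x = 0")
    case False
    then have "m \<le> ((1 / norm x) *\<^sub>R x) \<bullet> A ((1 / norm x) *\<^sub>R x)"
      unfolding m_def using that assms(3) by (intro min) (simp add: subspace_scale)
    also have "\<dots> = (x \<bullet> A x) / (x \<bullet> x)"
      by (simp add: linear_scale[OF assms(1)] dot_square_norm power2_eq_square)
    finally show ?thesis
      using False by (simp add: field_simps)
  qed simp
  \<comment> \<open>The residual of the eigenvalue equation, up to a factor the gradient of the
    Rayleigh quotient at \<open>v\<close>. Moving \<open>v\<close> along \<open>z\<close> within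
    \<open>W\<close> gives a nonnegative quadratic in \<open>t\<close> with linear coefficient
    \<open>z \<bullet> z\<close>, which must vanish.\<close>
  define z where "z = A v - m *\<^sub>R v"
  have zW: "z \<in> W"
    unfolding z_def by (intro subspace_diff subspace_scale assms(3) inv vW)
  have "2 * t * (z \<bullet> z) + t * t * (z \<bullet> A z - m * (z \<bullet> z)) \<ge> 0" for t
  proof -
    have "v + t *\<^sub>R z \<in> W"
      by (intro subspace_add subspace_scale assms(3) vW zW)
    then have "(v + t *\<^sub>R z) \<bullet> A (v + t *\<^sub>R z) - m * ((v + t *\<^sub>R z) \<bullet> (v + t *\<^sub>R z)) \<ge> 0"
      using ge by simp
    also have "(v + t *\<^sub>R z) \<bullet> A (v + t *\<^sub>R z) - m * ((v + t *\<^sub>R z) \<bullet> (v + t *\<^sub>R z)) =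
        2 * t * (z \<bullet> A v - m * (z \<bullet> v)) + t * t * (z \<bullet> A z - m * (z \<bullet> z))"
      using sym[of v z] vv
      by (simp add: linear_add[OF assms(1)] linear_scale[OF assms(1)] inner_add_left inner_add_right
          inner_commute[of v z] inner_commute[of "A v" z] m_def[symmetric] algebra_simps)
    also have "z \<bullet> A v - m * (z \<bullet> v) = z \<bullet> z"
      by (subst (4) z_def) (simp add: inner_diff_right)
    finally show ?thesis .
  qed
  from nonneg_quadratic_linear_part_zero[OF this] have "A v = m *\<^sub>R v"
    by (simp add: z_def)
  moreover have "v \<noteq> 0" using vv by auto
  ultimately show ?thesis using that vW by blast
qed

text \<open>Otherwise \<open>A\<close> has an eigenvector in the range of \<open>B = (A - l1) (A - l2)\<close>; it lies in the kernel
  of \<open>B\<close> as well, but kernel and range of the symmetric operator \<open>B\<close> are orthogonal.\<close>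

lemma symmetric_two_eigenvalues:
  fixes A :: "'v::euclidean_space \<Rightarrow> 'v"
  assumes lin: "linear A" and sym: "\<And>a b. A a \<bullet> b = a \<bullet> A b"
    and eig: "\<And>l v. \<lbrakk>v \<noteq> 0; A v = l *\<^sub>R v\<rbrakk> \<Longrightarrow> l = l1 \<or> l = l2"
  shows "A (A a) = (l1 + l2) *\<^sub>R A a - (l1 * l2) *\<^sub>R a"
proof -
  note [simp] = linear_add[OF lin] linear_diff[OF lin] linear_scale[OF lin]
  define B where "B v = A (A v) - (l1 + l2) *\<^sub>R A v + (l1 * l2) *\<^sub>R v" for v
  have linB: "linear B"
    by (rule linearI) (simp_all add: B_def algebra_simps)
  have symB: "B v \<bullet> w = v \<bullet> B w" for v w
    by (simp add: B_def inner_add_left inner_add_right inner_diff_left inner_diff_right sym)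
  have AB: "A (B v) = B (A v)" for v
    by (simp add: B_def)
  have "range B = {0}"
  proof (rule ccontr)
    assume "range B \<noteq> {0}"
    moreover have "subspace (range B)"
      by (rule linear_subspace_image[OF linB subspace_UNIV])
    moreover have "A w \<in> range B" if "w \<in> range B" for w
      using that by (auto simp: AB)
    ultimately obtain v l where v: "v \<in> range B" "v \<noteq> 0" "A v = l *\<^sub>R v"
      using symmetric_eigenvector_exists[OF lin sym] by metis
    then obtain w where w: "v = B w" by blast
    have "B v = ((l - l1) * (l - l2)) *\<^sub>R v"
      by (simp add: B_def v(3) algebra_simps)
    then have "B v = 0" using eig[OF v(2,3)] by auto
    then have "v \<bullet> v = 0"
      using symB[of w v] by (simp add: w)
    then show False using v(2) by simp
  qed
  then have "B a = 0" by blast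
  then show ?thesis by (simp add: B_def algebra_simps)
qed

text \<open>The map with columns \<open>e i\<close> has the inverse
  \<open>x \<mapsto> (e j \<bullet> x)\<close> on its image, so it is injective and therefore onto:
  n orthonormal vectors span.\<close>

lemma parseval:
  fixes e :: "'n::finite \<Rightarrow> real^'n"
  assumes "\<And>i j. e i \<bullet> e j = (if i = j then 1 else 0)"
  shows "(\<Sum>j\<in>UNIV. (e j \<bullet> a) * (e j \<bullet> b)) = a \<bullet> b"
proof -
  define S where "S x = (\<Sum>i\<in>UNIV. x $ i *\<^sub>R e i)" for x :: "real^'n"
  have lin: "linear S"
    by (rule linearI) (simp_all add: S_def algebra_simps sum.distrib scaleR_sum_right)
  have eS: "e j \<bullet> S x = x $ j" for j x
    by (simp add: S_def inner_sum_right assms if_distrib cong: if_cong)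
  have SS: "S x \<bullet> S y = (\<Sum>j\<in>UNIV. x $ j * y $ j)" for x y
    by (subst S_def[of x]) (simp add: inner_sum_left eS)
  have "inj S"
    by (rule injI) (metis eS vec_eq_iff)
  then have "surj S" using linear_inj_imp_surj[OF lin] by blast
  then obtain x y where "a = S x" "b = S y" by (metis surjD)
  then show ?thesis by (simp add: eS SS)
qed

text \<open>\<open>A\<close> is \<open>l2\<close> times the identity plus \<open>(l1 - l2)\<close>
  times the orthogonal projection onto the \<open>l1\<close>-eigenspace, and the trace of a
  projection is the dimension of its image. The orthonormal frame is arbitrary, since
  \<open>ricci\<close> works with a chosen one.\<close>

lemma trace_two_eigenvalues:
  fixes A :: "real^'n::finite \<Rightarrow> real^'n" and e :: "'n \<Rightarrow> real^'n"
  assumes lin: "linear A" and sym: "\<And>a b. A a \<bullet> b = a \<bullet> A b"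
    and quad: "\<And>a. A (A a) = (l1 + l2) *\<^sub>R A a - (l1 * l2) *\<^sub>R a" and "l1 \<noteq> l2"
    and e: "\<And>i j. e i \<bullet> e j = (if i = j then 1 else 0)"
  shows "(\<Sum>j\<in>UNIV. e j \<bullet> A (e j)) =
    real (dim {a. A a = l1 *\<^sub>R a}) * l1 + (real CARD('n) - real (dim {a. A a = l1 *\<^sub>R a})) * l2"
proof -
  note [simp] = linear_add[OF lin] linear_diff[OF lin] linear_scale[OF lin]
  define E where "E = {a. A a = l1 *\<^sub>R a}"
  have "subspace E"
    by (rule subspaceI) (simp_all add: E_def linear_0[OF lin] scaleR_add_right)
  then obtain B where B: "B \<subseteq> E" "pairwise orthogonal B" "\<And>x. x \<in> B \<Longrightarrow> norm x = 1"
    "independent B" "card B = dim E" "span B = E"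
    using orthonormal_basis_subspace by metis
  have fin: "finite B" using B(4) by (rule independent_imp_finite)
  \<comment> \<open>the orthogonal projection onto \<open>E\<close>\<close>
  define P where "P a = (1 / (l1 - l2)) *\<^sub>R (A a - l2 *\<^sub>R a)" for a
  have A: "A a = l2 *\<^sub>R a + (l1 - l2) *\<^sub>R P a" for a
    using assms(4) by (simp add: P_def)
  \<comment> \<open>The quadratic identity says that \<open>A - l1\<close> annihilates the range of
    \<open>A - l2\<close>.\<close>
  have PE: "P a \<in> E" for a
    by (simp add: P_def E_def quad algebra_simps)
  have Pb: "P b = b" if "b \<in> E" for b
    using that assms(4) by (simp add: P_def E_def scaleR_diff_left[symmetric])
  have symP: "P a \<bullet> b = a \<bullet> P b" for a b
    by (simp add: P_def inner_diff_left inner_diff_right sym)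
  have "a \<bullet> P a = (\<Sum>b\<in>B. (a \<bullet> b) * (a \<bullet> b))" for a
  proof -
    have "P a = (\<Sum>b\<in>B. (P a \<bullet> b) *\<^sub>R b)"
      using orthonormal_basis_expand[OF B(2,3) _ fin, of "P a"] PE B(6) by simp
    also have "\<dots> = (\<Sum>b\<in>B. (a \<bullet> b) *\<^sub>R b)"
      using B(1) by (intro sum.cong) (auto simp: symP Pb subset_iff)
    finally have "a \<bullet> P a = a \<bullet> (\<Sum>b\<in>B. (a \<bullet> b) *\<^sub>R b)" by simp
    then show ?thesis by (simp add: inner_sum_right)
  qed
  \<comment> \<open>After exchanging the sums, Parseval turns each inner sum into the squared norm
    of a unit vector of \<open>B\<close>.\<close>
  then have "(\<Sum>j\<in>UNIV. e j \<bullet> P (e j)) = (\<Sum>b\<in>B. \<Sum>j\<in>UNIV. (e j \<bullet> b) * (e j \<bullet> b))"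
    by (simp add: sum.swap[of _ B])
  also have "\<dots> = (\<Sum>b\<in>B. 1)"
    using B(3) by (intro sum.cong) (auto simp: parseval[OF e] norm_eq_1)
  finally have tr: "(\<Sum>j\<in>UNIV. e j \<bullet> P (e j)) = real (dim E)"
    by (simp add: B(5))
  have "(\<Sum>j\<in>UNIV. e j \<bullet> A (e j)) = (\<Sum>j\<in>UNIV. l2 + (l1 - l2) * (e j \<bullet> P (e j)))"
    by (subst A) (simp add: inner_add_right e)
  also have "\<dots> = real CARD('n) * l2 + (l1 - l2) * real (dim E)"
    by (simp add: sum.distrib sum_distrib_left[symmetric] tr)
  finally show ?thesis by (simp add: E_def algebra_simps)
qed

section \<open>Curvature-like tensors in an adapted frame\<close>

context adapted_frame
begin

lemma A_symmetric': "b \<bullet> A a = a \<bullet> A b"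
  using A_symmetric[of a b] by (simp add: inner_commute)

text \<open>\<open>B\<close> and \<open>R\<close> become \<open>shape_tensor\<close> and
  \<open>Rstar\<close> on a hypersurface; here they depend on \<open>h\<close> and \<open>T\<close>
  alone, so that the rest is linear algebra at one point.\<close>

definition B :: "real^('n option) \<Rightarrow> real^('n option) \<Rightarrow> real" where
  "B X Y = h X (T Y)"

definition R :: "real^('n option) \<Rightarrow> real^('n option) \<Rightarrow> real^('n option) \<Rightarrow> real^('n option) \<Rightarrow> real"
  where "R X1 X2 X3 X4 = 1 / 2 * kulkarni_nomizu B B X1 X2 X3 X4"

lemma B_frame: "B (\<phi> a) (\<phi> b) = a \<bullet> A b"
  by (simp add: B_def operator_frame metric_frame)

lemma R_frame:
  "R (\<phi> a) (\<phi> b) (\<phi> c) (\<phi> d) = (a \<bullet> A d) * (b \<bullet> A c) - (a \<bullet> A c) * (b \<bullet> A d)"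
  by (simp add: R_def kulkarni_nomizu_def B_frame algebra_simps)

lemma eigenspace_frame: "{X \<in> V. T X = l *\<^sub>R X} = \<phi> ` {a. A a = l *\<^sub>R a}"
proof -
  have "T (\<phi> a) = l *\<^sub>R \<phi> a \<longleftrightarrow> A a = l *\<^sub>R a" for a
    using inj_frame by (simp add: operator_frame linear_scale[OF linear_frame, symmetric] inj_eq)
  then show ?thesis
    unfolding range_frame[symmetric] by auto
qed

lemma dim_eigenspace_frame: "dim {X \<in> V. T X = l *\<^sub>R X} = dim {a. A a = l *\<^sub>R a}"
  unfolding eigenspace_frame using inj_frame
  by (intro dim_image_eq linear_frame) (rule inj_on_subset, auto)

text \<open>The vector is read off from \<open>R_frame\<close> by moving \<open>A\<close> across the
  inner product; nondegeneracy of the inner product makes it unique.\<close>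

lemma curvature_operator_frame:
  "curvature_operator V h R (\<phi> a) (\<phi> b) (\<phi> c) = \<phi> ((b \<bullet> A c) *\<^sub>R A a - (a \<bullet> A c) *\<^sub>R A b)"
  unfolding curvature_operator_def
proof (rule the_equality)
  let ?w = "(b \<bullet> A c) *\<^sub>R A a - (a \<bullet> A c) *\<^sub>R A b"
  have w: "h (\<phi> ?w) (\<phi> d) = R (\<phi> a) (\<phi> b) (\<phi> c) (\<phi> d)" for d
    by (simp add: metric_frame R_frame inner_diff_left A_symmetric)
  then show "\<phi> ?w \<in> V \<and> (\<forall>X4\<in>V. h (\<phi> ?w) X4 = R (\<phi> a) (\<phi> b) (\<phi> c) X4)"
    unfolding range_frame[symmetric] by auto
  fix W assume W: "W \<in> V \<and> (\<forall>X4\<in>V. h W X4 = R (\<phi> a) (\<phi> b) (\<phi> c) X4)"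
  then obtain v where v: "W = \<phi> v"
    unfolding range_frame[symmetric] by auto
  have "v \<bullet> d = ?w \<bullet> d" for d
    using W w[of d] unfolding range_frame[symmetric] v by (auto simp: metric_frame)
  then show "W = \<phi> ?w"
    unfolding v by (metis vector_eq_rdot)
qed

lemma wedge_operator_frame:
  "wedge_operator h (\<phi> a) (\<phi> b) (\<phi> c) = \<phi> ((b \<bullet> c) *\<^sub>R a - (a \<bullet> c) *\<^sub>R b)"
  by (simp add: wedge_operator_def metric_frame linear_diff[OF linear_frame]
      linear_scale[OF linear_frame])

lemma dot_tensor_eq_Q_tensor:
  assumes quad: "\<And>a. A (A a) = (l1 + l2) *\<^sub>R A a - (l1 * l2) *\<^sub>R a"
    and "X1 \<in> V" "X2 \<in> V" "X3 \<in> V" "X4 \<in> V" "X \<in> V" "Y \<in> V"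
  shows "dot_tensor V h R R X1 X2 X3 X4 X Y = l1 * l2 * Q_tensor h R X1 X2 X3 X4 X Y"
proof -
  obtain a b c d x y where "X1 = \<phi> a" "X2 = \<phi> b" "X3 = \<phi> c" "X4 = \<phi> d" "X = \<phi> x" "Y = \<phi> y"
    using assms(2-) unfolding range_frame[symmetric] by auto
  note eqs = this
  define C where "C z = (y \<bullet> A z) *\<^sub>R A x - (x \<bullet> A z) *\<^sub>R A y" for z
  define W where "W z = (y \<bullet> z) *\<^sub>R x - (x \<bullet> z) *\<^sub>R y" for z
  \<comment> \<open>up to sign, the derivation \<open>K\<close> applied to the form \<open>B\<close>\<close>
  define q where "q K z w = K z \<bullet> A w + z \<bullet> A (K w)" for K z w
  have AA: "A v \<bullet> A w = (l1 + l2) * (v \<bullet> A w) - l1 * l2 * (v \<bullet> w)" for v w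
    by (simp add: A_symmetric quad inner_diff_right)
  have C: "q C z w = (y \<bullet> A z) * (A x \<bullet> A w) - (x \<bullet> A z) * (A y \<bullet> A w) +
      (y \<bullet> A w) * (A x \<bullet> A z) - (x \<bullet> A w) * (A y \<bullet> A z)" for z w
    by (simp add: q_def C_def A_symmetric[of z, symmetric] inner_diff_left inner_diff_right
        inner_commute[of "A z" "A x"] inner_commute[of "A z" "A y"])
  have W: "q W z w = (y \<bullet> z) * (x \<bullet> A w) - (x \<bullet> z) * (y \<bullet> A w) +
      (y \<bullet> w) * (x \<bullet> A z) - (x \<bullet> w) * (y \<bullet> A z)" for z w
    by (simp add: q_def W_def A_symmetric[of z, symmetric] inner_diff_left inner_diff_right
        inner_commute[of "A z" x] inner_commute[of "A z" y])
  \<comment> \<open>After substituting \<open>AA\<close> the four terms with the factor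
    \<open>l1 + l2\<close> cancel in pairs, and those with \<open>l1 * l2\<close> form the
    expression for \<open>W\<close>.\<close>
  have CW: "q C z w = l1 * l2 * q W z w" for z w
    by (simp add: C W AA algebra_simps)
  \<comment> \<open>The product rule for a derivation on the quadratic expression \<open>R\<close>
    in \<open>B\<close>; since \<open>K\<close> is arbitrary, it serves both \<open>C\<close> and
    \<open>W\<close>.\<close>
  have act: "- (R (\<phi> (K a)) (\<phi> b) (\<phi> c) (\<phi> d) + R (\<phi> a) (\<phi> (K b)) (\<phi> c) (\<phi> d) +
      R (\<phi> a) (\<phi> b) (\<phi> (K c)) (\<phi> d) + R (\<phi> a) (\<phi> b) (\<phi> c) (\<phi> (K d))) =
    - (q K a d * (b \<bullet> A c) - q K a c * (b \<bullet> A d) + (a \<bullet> A d) * q K b c - (a \<bullet> A c) * q K b d)" for K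
    by (simp add: R_frame q_def algebra_simps)
  have "dot_tensor V h R R X1 X2 X3 X4 X Y =
    - (q C a d * (b \<bullet> A c) - q C a c * (b \<bullet> A d) + (a \<bullet> A d) * q C b c - (a \<bullet> A c) * q C b d)"
    unfolding eqs dot_tensor_def Let_def curvature_operator_frame C_def[symmetric] by (rule act)
  also have "\<dots> = l1 * l2 *
    - (q W a d * (b \<bullet> A c) - q W a c * (b \<bullet> A d) + (a \<bullet> A d) * q W b c - (a \<bullet> A c) * q W b d)"
    unfolding CW by (simp add: algebra_simps)
  also have "\<dots> = l1 * l2 * Q_tensor h R X1 X2 X3 X4 X Y"
    unfolding eqs Q_tensor_def Let_def wedge_operator_frame W_def[symmetric] act ..
  finally show ?thesis .
qed

text \<open>A witness for the choices of a basis made in \<open>ricci\<close> and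
  \<open>form_rank\<close>.\<close>

lemma is_frame_axis: "is_frame V (\<lambda>i. \<phi> (axis i 1))"
proof -
  have inj: "inj (\<lambda>i. \<phi> (axis i (1::real)))"
    by (rule injI) (simp add: inj_eq[OF inj_frame] axis_eq_axis)
  have range: "range (\<lambda>i. \<phi> (axis i (1::real))) = \<phi> ` Basis"
    by (auto simp: Basis_vec_def)
  have "independent (\<phi> ` Basis)"
    by (rule linear_independent_injective_image[OF linear_frame independent_Basis])
      (rule inj_on_subset[OF inj_frame subset_UNIV])
  moreover have "span (\<phi> ` Basis) = V"
    using linear_span_image[OF linear_frame, of Basis] by (simp add: range_frame)
  ultimately show ?thesis
    unfolding is_frame_def range using inj by blast
qed

text \<open>Contraction gives the trace of \<open>A\<close> times \<open>A\<close>, minus the square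
  of \<open>A\<close>. The quadratic identity expresses that square through \<open>A\<close> and the
  identity, leaving \<open>A\<close> with the coefficient
  \<open>k l1 + (n - k) l2 - (l1 + l2)\<close>.\<close>

lemma ricci_frame:
  assumes quad: "\<And>a. A (A a) = (l1 + l2) *\<^sub>R A a - (l1 * l2) *\<^sub>R a" and "l1 \<noteq> l2"
    and k: "dim {a. A a = l1 *\<^sub>R a} = k"
  shows "ricci V h R (\<phi> a) (\<phi> b) =
    ((real k - 1) * l1 + (real CARD('n) - real k - 1) * l2) * (a \<bullet> A b) + l1 * l2 * (a \<bullet> b)"
proof -
  define on where "on e \<longleftrightarrow> is_frame V e \<and> (\<forall>i j. h (e i) (e j) = (if i = j then 1 else 0))" for e
  define e where "e = (SOME e. on e)"
  have "on (\<lambda>i. \<phi> (axis i 1))"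
    by (simp add: on_def is_frame_axis metric_frame inner_axis_axis)
  then have "on e" unfolding e_def by (rule someI[where P = on])
  then have V: "e j \<in> V" for j
    unfolding on_def is_frame_def by (metis span_base rangeI)
  then have "\<exists>a. e j = \<phi> a" for j
    unfolding range_frame[symmetric] by auto
  then obtain e' where e': "\<And>j. e j = \<phi> (e' j)" by metis
  have orth: "e' i \<bullet> e' j = (if i = j then 1 else 0)" for i j
    using \<open>on e\<close> by (simp add: on_def e' metric_frame)
  have "ricci V h R (\<phi> a) (\<phi> b) = (\<Sum>j\<in>UNIV. R (e j) (\<phi> a) (\<phi> b) (e j))"
    by (simp add: ricci_def e_def on_def[abs_def] Let_def)
  also have "\<dots> = (\<Sum>j\<in>UNIV. (e' j \<bullet> A (e' j)) * (a \<bullet> A b) - (e' j \<bullet> A b) * (e' j \<bullet> A a))"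
    by (simp add: e' R_frame A_symmetric'[of a])
  also have "\<dots> = (\<Sum>j\<in>UNIV. e' j \<bullet> A (e' j)) * (a \<bullet> A b) - A b \<bullet> A a"
    by (simp add: sum_subtractf sum_distrib_right parseval[OF orth])
  also have "A b \<bullet> A a = a \<bullet> A (A b)"
    using A_symmetric[of a "A b"] by (simp add: inner_commute)
  also have "\<dots> = (l1 + l2) * (a \<bullet> A b) - l1 * l2 * (a \<bullet> b)"
    by (simp add: quad inner_diff_right)
  finally show ?thesis
    unfolding trace_two_eigenvalues[OF linear_A A_symmetric quad assms(2) orth] k
    by (simp add: algebra_simps)
qed

text \<open>Subtracting \<open>l1 * l2 * h\<close> from the Ricci tensor leaves \<open>c\<close>
  times \<open>B\<close>; the Kulkarni-Nomizu square is quadratic, hence the factor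
  \<open>1 / (c * c)\<close>.\<close>

lemma R_eq_kulkarni_nomizu_ricci:
  assumes quad: "\<And>a. A (A a) = (l1 + l2) *\<^sub>R A a - (l1 * l2) *\<^sub>R a" and "l1 \<noteq> l2"
    and k: "dim {a. A a = l1 *\<^sub>R a} = k"
    and c: "c = (real k - 1) * l1 + (real CARD('n) - real k - 1) * l2" "c \<noteq> 0"
    and "X1 \<in> V" "X2 \<in> V" "X3 \<in> V" "X4 \<in> V"
  shows "R X1 X2 X3 X4 = 1 / (c * c) / 2 * kulkarni_nomizu
    (\<lambda>X Y. ricci V h R X Y - l1 * l2 * h X Y) (\<lambda>X Y. ricci V h R X Y - l1 * l2 * h X Y) X1 X2 X3 X4"
proof -
  obtain x y z w where "X1 = \<phi> x" "X2 = \<phi> y" "X3 = \<phi> z" "X4 = \<phi> w"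
    using assms(6-) unfolding range_frame[symmetric] by auto
  moreover have "ricci V h R (\<phi> a) (\<phi> b) - l1 * l2 * h (\<phi> a) (\<phi> b) = c * (a \<bullet> A b)" for a b
    by (simp add: ricci_frame[OF quad assms(2) k] metric_frame c(1))
  ultimately show ?thesis
    using c(2) by (simp add: kulkarni_nomizu_def R_frame field_simps)
qed

text \<open>The Gram matrix of the form in any frame factors through \<open>A - l1\<close>, with an
  onto map before it and an injective map after it, so its rank is the dimension of the range of
  \<open>A - l1\<close>, which is the \<open>l2\<close>-eigenspace.\<close>

lemma form_rank_shifted:
  assumes quad: "\<And>a. A (A a) = (l1 + l2) *\<^sub>R A a - (l1 * l2) *\<^sub>R a" and "l1 \<noteq> l2"
  shows "form_rank V (\<lambda>X Y. B X Y - l1 * h X Y) = dim {a. A a = l2 *\<^sub>R a}"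
proof -
  note [simp] = linear_add[OF linear_A] linear_diff[OF linear_A] linear_scale[OF linear_A]
  define b where "b = (SOME b. is_frame V b)"
  have "is_frame V b"
    unfolding b_def by (rule someI[where P = "is_frame V", OF is_frame_axis])
  then have spanb: "span (range b) = V"
    by (simp add: is_frame_def)
  then have bV: "b i \<in> V" for i
    using span_base[of "b i" "range b"] by auto
  have "\<exists>a. b j = \<phi> a" for j
    using bV[of j] unfolding range_frame[symmetric] by auto
  then obtain b' where b': "\<And>j. b j = \<phi> (b' j)" by metis
  have "range b = \<phi> ` range b'" using b' by auto
  then have "\<phi> ` span (range b') = range \<phi>"
    using spanb linear_span_image[OF linear_frame, of "range b'"] range_frame by simp
  then have span': "span (range b') = UNIV"
    using inj_frame by (metis inj_image_eq_iff)
  \<comment> \<open>The three factors: \<open>L\<close> builds a vector from its coefficients,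
    \<open>D\<close> is \<open>A - l1\<close>, and \<open>H\<close> pairs with the frame.\<close>
  define L where "L v = (\<Sum>j\<in>UNIV. v $ j *\<^sub>R b' j)" for v :: "real^'n"
  define H where "H a = (\<chi> i. b' i \<bullet> a)" for a :: "real^'n"
  define D where "D a = A a - l1 *\<^sub>R a" for a
  have linL: "linear L"
    by (rule linearI) (simp_all add: L_def algebra_simps sum.distrib scaleR_sum_right)
  have "b' j \<in> range L" for j
  proof -
    have "L (axis j 1) = b' j"
      by (simp add: L_def axis_def if_distrib[of "\<lambda>r. r *\<^sub>R _"] cong: if_cong)
    then show ?thesis by (metis rangeI)
  qed
  then have "span (range b') \<subseteq> range L"
    by (intro span_minimal linear_subspace_image[OF linL subspace_UNIV]) auto
  then have surjL: "range L = UNIV" using span' by auto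
  have linH: "linear H"
    by (rule linearI) (simp_all add: H_def vec_eq_iff inner_add_right)
  have injH: "inj H"
  proof (rule linear_injective_0[OF linH, THEN iffD2], intro allI impI)
    fix a assume "H a = 0"
    then have "orthogonal a v" if "v \<in> range b'" for v
      using that by (auto simp: H_def vec_eq_iff orthogonal_def inner_commute)
    then have "orthogonal a a"
      using orthogonal_to_span[of a "range b'"] span' by (metis UNIV_I orthogonal_commute)
    then show "a = 0" by (simp add: orthogonal_def)
  qed
  have linD: "linear D"
    by (rule linearI) (simp_all add: D_def algebra_simps)
  \<comment> \<open>One inclusion is the quadratic identity; for the other, \<open>D\<close> acts on
    the \<open>l2\<close>-eigenspace as multiplication by \<open>l2 - l1\<close>, which is
    invertible.\<close>
  have rangeD: "range D = {a. A a = l2 *\<^sub>R a}"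
  proof safe
    show "A (D a) = l2 *\<^sub>R D a" for a
      by (simp add: D_def quad algebra_simps)
    show "a \<in> range D" if "A a = l2 *\<^sub>R a" for a
    proof -
      have "a = D ((1 / (l2 - l1)) *\<^sub>R a)"
        using that assms(2) by (simp add: D_def scaleR_diff_left[symmetric] diff_divide_distrib[symmetric])
      then show ?thesis by blast
    qed
  qed
  define E where "E X Y = B X Y - l1 * h X Y" for X Y
  have E: "E (\<phi> a) (\<phi> c) = a \<bullet> D c" for a c
    by (simp add: E_def B_frame metric_frame D_def inner_diff_right)
  have "((\<chi> i j. E (b i) (b j)) :: real^'n^'n) *v v = H (D (L v))" for v
    by (simp add: matrix_vector_mult_def vec_eq_iff H_def L_def linear_sum[OF linD]
        linear_scale[OF linD] inner_sum_right b' E mult.commute)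
  then have "range (\<lambda>v. ((\<chi> i j. E (b i) (b j)) :: real^'n^'n) *v v) = H ` D ` range L"
    by auto
  then have "rank ((\<chi> i j. E (b i) (b j)) :: real^'n^'n) = dim (H ` {a. A a = l2 *\<^sub>R a})"
    by (simp add: rank_dim_range surjL rangeD)
  also have "\<dots> = dim {a. A a = l2 *\<^sub>R a}"
    using injH by (intro dim_image_eq linH) (rule inj_on_subset, auto)
  finally show ?thesis
    by (simp add: form_rank_def b_def E_def[abs_def])
qed

end

section \<open>Pointwise statements on the hypersurface\<close>

lemma two_curvatures_frame:
  assumes "adapted_frame \<phi> A (tangent_space M F x) (blaschke_metric M F \<xi> x) (shape_operator M F \<xi> x)"
    and "two_curvatures M F \<xi> x l1 l2"
  shows "A (A a) = (l1 + l2) *\<^sub>R A a - (l1 * l2) *\<^sub>R a"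
proof -
  interpret adapted_frame \<phi> A "tangent_space M F x" "blaschke_metric M F \<xi> x" "shape_operator M F \<xi> x"
    by fact
  \<comment> \<open>\<open>\<phi>\<close> maps eigenvectors of \<open>A\<close> to principal
    directions, so every eigenvalue of \<open>A\<close> is a principal curvature.\<close>
  have "l = l1 \<or> l = l2" if v: "v \<noteq> 0" "A v = l *\<^sub>R v" for l v
  proof -
    have "\<phi> v \<noteq> 0"
      using v(1) linear_frame inj_frame by (auto simp: linear_inj_iff_eq_0)
    moreover have "\<phi> v \<in> {X \<in> tangent_space M F x. shape_operator M F \<xi> x X = l *\<^sub>R X}"
      unfolding eigenspace_frame using v(2) by blast
    ultimately have "l \<in> principal_curvatures M F \<xi> x"
      unfolding principal_curvatures_def by blast
    then show ?thesis
      using assms(2) by (auto simp: two_curvatures_def)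
  qed
  then show ?thesis
    by (rule symmetric_two_eigenvalues[OF linear_A A_symmetric])
qed

lemma dot_tensor_Rstar:
  fixes F \<xi> :: "'a \<Rightarrow> real^('n::finite option)"
  assumes "hypersurface M F" "affine_normal M F \<xi>" "locally_strongly_convex M F \<xi>" "x \<in> topspace M"
    and "two_curvatures M F \<xi> x l1 l2"
    and "X1 \<in> tangent_space M F x" "X2 \<in> tangent_space M F x" "X3 \<in> tangent_space M F x"
      "X4 \<in> tangent_space M F x" "X \<in> tangent_space M F x" "Y \<in> tangent_space M F x"
  shows "dot_tensor (tangent_space M F x) (blaschke_metric M F \<xi> x)
      (Rstar M F \<xi> x) (Rstar M F \<xi> x) X1 X2 X3 X4 X Y =
    l1 * l2 * Q_tensor (blaschke_metric M F \<xi> x) (Rstar M F \<xi> x) X1 X2 X3 X4 X Y"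
proof -
  obtain \<phi> A where frame:
    "adapted_frame \<phi> A (tangent_space M F x) (blaschke_metric M F \<xi> x) (shape_operator M F \<xi> x)"
    by (rule adapted_frame_exists[OF assms(1-4)])
  interpret adapted_frame \<phi> A "tangent_space M F x" "blaschke_metric M F \<xi> x" "shape_operator M F \<xi> x"
    by (rule frame)
  have "Rstar M F \<xi> x = R"
    by (simp add: fun_eq_iff R_def Rstar_def shape_tensor_def B_def kulkarni_nomizu_def)
  then show ?thesis
    using dot_tensor_eq_Q_tensor[OF two_curvatures_frame[OF frame assms(5)] assms(6-)] by simp
qed

lemma Rstar_eq_kulkarni_nomizu:
  fixes F \<xi> :: "'a \<Rightarrow> real^('n::finite option)"
  assumes "hypersurface M F" "affine_normal M F \<xi>" "locally_strongly_convex M F \<xi>" "x \<in> topspace M"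
    and curv: "two_curvatures_mult M F \<xi> x l1 l2 k"
    and c: "c = (real k - 1) * l1 + (real CARD('n) - real k - 1) * l2" "c \<noteq> 0"
    and "X1 \<in> tangent_space M F x" "X2 \<in> tangent_space M F x" "X3 \<in> tangent_space M F x"
      "X4 \<in> tangent_space M F x"
  shows "Rstar M F \<xi> x X1 X2 X3 X4 = 1 / (c * c) / 2 * kulkarni_nomizu
      (\<lambda>X Y. Ric_Rstar M F \<xi> x X Y - l1 * l2 * blaschke_metric M F \<xi> x X Y)
      (\<lambda>X Y. Ric_Rstar M F \<xi> x X Y - l1 * l2 * blaschke_metric M F \<xi> x X Y) X1 X2 X3 X4"
proof -
  obtain \<phi> A where frame:
    "adapted_frame \<phi> A (tangent_space M F x) (blaschke_metric M F \<xi> x) (shape_operator M F \<xi> x)"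
    by (rule adapted_frame_exists[OF assms(1-4)])
  interpret adapted_frame \<phi> A "tangent_space M F x" "blaschke_metric M F \<xi> x" "shape_operator M F \<xi> x"
    by (rule frame)
  have R: "Rstar M F \<xi> x = R"
    by (simp add: fun_eq_iff R_def Rstar_def shape_tensor_def B_def kulkarni_nomizu_def)
  have tc: "two_curvatures M F \<xi> x l1 l2" and ne: "l1 \<noteq> l2"
    and k: "dim {a. A a = l1 *\<^sub>R a} = k"
    using curv unfolding two_curvatures_mult_def two_curvatures_def multiplicity_at_def
      dim_eigenspace_frame by auto
  show ?thesis
    unfolding R Ric_Rstar_def
    by (rule R_eq_kulkarni_nomizu_ricci[OF two_curvatures_frame[OF frame tc] ne k c assms(8-)])
qed

text \<open>The witness is \<open>\<rho> = l1\<close>: the rank of \<open>S - l1 h\<close> is the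
  multiplicity of \<open>l2\<close>, which is 4 - 2. Two distinct eigenvalues exclude a multiple of
  the identity.\<close>

lemma two_quasi_umbilical_at_mult_2:
  fixes F \<xi> :: "'a \<Rightarrow> real^('n::finite option)"
  assumes "hypersurface M F" "affine_normal M F \<xi>" "locally_strongly_convex M F \<xi>" "x \<in> topspace M"
    and "CARD('n) = 4" and curv: "two_curvatures_mult M F \<xi> x l1 l2 2"
  shows "two_quasi_umbilical_at M F \<xi> x"
proof -
  obtain \<phi> A where frame:
    "adapted_frame \<phi> A (tangent_space M F x) (blaschke_metric M F \<xi> x) (shape_operator M F \<xi> x)"
    by (rule adapted_frame_exists[OF assms(1-4)])
  interpret adapted_frame \<phi> A "tangent_space M F x" "blaschke_metric M F \<xi> x" "shape_operator M F \<xi> x"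
    by (rule frame)
  have tc: "two_curvatures M F \<xi> x l1 l2" and ne: "l1 \<noteq> l2"
    and pc: "principal_curvatures M F \<xi> x = {l1, l2}"
    and k: "dim {a. A a = l2 *\<^sub>R a} = 2"
    using curv assms(5) unfolding two_curvatures_mult_def two_curvatures_def multiplicity_at_def
      dim_eigenspace_frame by auto
  have "l = c" if "l \<in> principal_curvatures M F \<xi> x"
    "\<forall>X\<in>tangent_space M F x. shape_operator M F \<xi> x X = c *\<^sub>R X" for l c
    using that by (auto simp: principal_curvatures_def)
  then have "\<not> (\<exists>c. \<forall>X\<in>tangent_space M F x. shape_operator M F \<xi> x X = c *\<^sub>R X)"
    using ne unfolding pc by blast
  moreover have "form_rank (tangent_space M F x)
      (\<lambda>X Y. shape_tensor M F \<xi> x X Y - l1 * blaschke_metric M F \<xi> x X Y) = 2"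
    using form_rank_shifted[OF two_curvatures_frame[OF frame tc] ne] k
    by (simp add: B_def shape_tensor_def)
  ultimately show ?thesis
    using assms(5) unfolding two_quasi_umbilical_at_def by auto
qed

text \<open>Meant for the weights k - 1 and n - k - 1, positive when both multiplicities are at
  least 2: the summands either have the same sign or exactly one of them vanishes, so nothing
  cancels.\<close>

lemma weighted_sum_nonzero:
  fixes p q a b :: real
  assumes "p > 0" "q > 0"
    and "(a > 0 \<and> b > 0) \<or> (a < 0 \<and> b < 0) \<or> (a \<noteq> 0 \<and> b = 0) \<or> (a = 0 \<and> b \<noteq> 0)"
  shows "p * a + q * b \<noteq> 0"
  using assms(3)
proof (elim disjE conjE)
  assume "a > 0" "b > 0"
  then have "p * a + q * b > 0" using assms(1,2) by (simp add: add_pos_pos)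
  then show ?thesis by simp
next
  assume "a < 0" "b < 0"
  then have "p * a + q * b < 0" using assms(1,2) by (simp add: add_neg_neg mult_pos_neg)
  then show ?thesis by simp
qed (use assms(1,2) in auto)

theorem theorem6p7:
  fixes M :: "'a topology"
    and F \<xi> :: "'a \<Rightarrow> real^('n::finite option)"
    and l1 l2 :: "'a \<Rightarrow> real"
    and k :: "'a \<Rightarrow> nat"
  assumes n_ge_4: "CARD('n) \<ge> 4"
    and hyp: "hypersurface M F"
    and normal: "affine_normal M F \<xi>"
    and convex: "locally_strongly_convex M F \<xi>"
  shows
    "((\<forall>x\<in>topspace M. two_curvatures M F \<xi> x (l1 x) (l2 x)) \<longrightarrow>
       (\<forall>x\<in>topspace M.
          \<forall>X1\<in>tangent_space M F x. \<forall>X2\<in>tangent_space M F x. \<forall>X3\<in>tangent_space M F x.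
          \<forall>X4\<in>tangent_space M F x. \<forall>X\<in>tangent_space M F x. \<forall>Y\<in>tangent_space M F x.
            dot_tensor (tangent_space M F x) (blaschke_metric M F \<xi> x)
              (Rstar M F \<xi> x) (Rstar M F \<xi> x) X1 X2 X3 X4 X Y =
            l1 x * l2 x * Q_tensor (blaschke_metric M F \<xi> x) (Rstar M F \<xi> x) X1 X2 X3 X4 X Y))
     \<and>
     ((\<forall>x\<in>topspace M.
          two_curvatures_mult M F \<xi> x (l1 x) (l2 x) (k x) \<and>
          (real (k x) - 1) * l1 x + (real CARD('n) - real (k x) - 1) * l2 x \<noteq> 0 \<and>
          2 \<le> k x \<and> k x \<le> CARD('n) - 2) \<longrightarrow>
       (\<exists>\<phi> :: 'a \<Rightarrow> real. \<forall>x\<in>topspace M.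
          \<forall>X1\<in>tangent_space M F x. \<forall>X2\<in>tangent_space M F x.
          \<forall>X3\<in>tangent_space M F x. \<forall>X4\<in>tangent_space M F x.
            Rstar M F \<xi> x X1 X2 X3 X4 =
            \<phi> x / 2 * kulkarni_nomizu
              (\<lambda>X Y. Ric_Rstar M F \<xi> x X Y - l1 x * l2 x * blaschke_metric M F \<xi> x X Y)
              (\<lambda>X Y. Ric_Rstar M F \<xi> x X Y - l1 x * l2 x * blaschke_metric M F \<xi> x X Y)
              X1 X2 X3 X4))
     \<and>
     ((\<forall>x\<in>topspace M.
          two_curvatures_mult M F \<xi> x (l1 x) (l2 x) (k x) \<and>
          k x \<ge> 2 \<and> CARD('n) - k x \<ge> 2 \<and>
          ((l1 x > 0 \<and> l2 x > 0) \<or> (l1 x < 0 \<and> l2 x < 0) \<or>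
           (l1 x \<noteq> 0 \<and> l2 x = 0) \<or> (l1 x = 0 \<and> l2 x \<noteq> 0))) \<longrightarrow>
       (\<forall>x\<in>topspace M.
          (real (k x) - 1) * l1 x + (real CARD('n) - real (k x) - 1) * l2 x \<noteq> 0 \<and>
          2 \<le> k x \<and> k x \<le> CARD('n) - 2) \<and>
       (\<exists>\<phi> :: 'a \<Rightarrow> real. \<forall>x\<in>topspace M.
          \<forall>X1\<in>tangent_space M F x. \<forall>X2\<in>tangent_space M F x.
          \<forall>X3\<in>tangent_space M F x. \<forall>X4\<in>tangent_space M F x.
            Rstar M F \<xi> x X1 X2 X3 X4 =
            \<phi> x / 2 * kulkarni_nomizu
              (\<lambda>X Y. Ric_Rstar M F \<xi> x X Y - l1 x * l2 x * blaschke_metric M F \<xi> x X Y)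
              (\<lambda>X Y. Ric_Rstar M F \<xi> x X Y - l1 x * l2 x * blaschke_metric M F \<xi> x X Y)
              X1 X2 X3 X4))
     \<and>
     (CARD('n) = 4 \<and>
       (\<forall>x\<in>topspace M. two_curvatures_mult M F \<xi> x (l1 x) (l2 x) 2) \<longrightarrow>
       two_quasi_umbilical M F \<xi>)"
proof -
  \<comment> \<open>Common to (ii) and (iii), which differ in how the nonvanishing of the
    coefficient is obtained.\<close>
  have part2: "\<exists>\<phi> :: 'a \<Rightarrow> real. \<forall>x\<in>topspace M.
      \<forall>X1\<in>tangent_space M F x. \<forall>X2\<in>tangent_space M F x.
      \<forall>X3\<in>tangent_space M F x. \<forall>X4\<in>tangent_space M F x.
        Rstar M F \<xi> x X1 X2 X3 X4 =
        \<phi> x / 2 * kulkarni_nomizu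
          (\<lambda>X Y. Ric_Rstar M F \<xi> x X Y - l1 x * l2 x * blaschke_metric M F \<xi> x X Y)
          (\<lambda>X Y. Ric_Rstar M F \<xi> x X Y - l1 x * l2 x * blaschke_metric M F \<xi> x X Y)
          X1 X2 X3 X4"
    if "\<And>x. x \<in> topspace M \<Longrightarrow> two_curvatures_mult M F \<xi> x (l1 x) (l2 x) (k x) \<and>
          (real (k x) - 1) * l1 x + (real CARD('n) - real (k x) - 1) * l2 x \<noteq> 0"
  proof -
    define c where "c x = (real (k x) - 1) * l1 x + (real CARD('n) - real (k x) - 1) * l2 x" for x
    have ne: "c x \<noteq> 0" if "x \<in> topspace M" for x
      using \<open>\<And>x. x \<in> topspace M \<Longrightarrow> _\<close>[OF that] by (simp add: c_def)
    show ?thesis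
      using Rstar_eq_kulkarni_nomizu[OF hyp normal convex _ conjunct1[OF that] c_def ne]
      \<comment> \<open>The function required is the inverse square of the coefficient
        \<open>c x\<close>.\<close>
      by (intro exI[of _ "\<lambda>x. 1 / (c x * c x)"] ballI) blast
  qed
  have star: "(real (k x) - 1) * l1 x + (real CARD('n) - real (k x) - 1) * l2 x \<noteq> 0"
    if "k x \<ge> 2" "CARD('n) - k x \<ge> 2"
      "(l1 x > 0 \<and> l2 x > 0) \<or> (l1 x < 0 \<and> l2 x < 0) \<or>
       (l1 x \<noteq> 0 \<and> l2 x = 0) \<or> (l1 x = 0 \<and> l2 x \<noteq> 0)" for x
    by (rule weighted_sum_nonzero[OF _ _ that(3)]) (use that(1,2) in linarith)+
  show ?thesis
  proof (intro conjI impI)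
    show "\<forall>x\<in>topspace M.
          \<forall>X1\<in>tangent_space M F x. \<forall>X2\<in>tangent_space M F x. \<forall>X3\<in>tangent_space M F x.
          \<forall>X4\<in>tangent_space M F x. \<forall>X\<in>tangent_space M F x. \<forall>Y\<in>tangent_space M F x.
            dot_tensor (tangent_space M F x) (blaschke_metric M F \<xi> x)
              (Rstar M F \<xi> x) (Rstar M F \<xi> x) X1 X2 X3 X4 X Y =
            l1 x * l2 x * Q_tensor (blaschke_metric M F \<xi> x) (Rstar M F \<xi> x) X1 X2 X3 X4 X Y"
      if "\<forall>x\<in>topspace M. two_curvatures M F \<xi> x (l1 x) (l2 x)"
      using that by (intro ballI dot_tensor_Rstar[OF hyp normal convex]) auto
  next
    assume "\<forall>x\<in>topspace M. two_curvatures_mult M F \<xi> x (l1 x) (l2 x) (k x) \<and>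
          (real (k x) - 1) * l1 x + (real CARD('n) - real (k x) - 1) * l2 x \<noteq> 0 \<and>
          2 \<le> k x \<and> k x \<le> CARD('n) - 2"
    then show "\<exists>\<phi> :: 'a \<Rightarrow> real. \<forall>x\<in>topspace M.
          \<forall>X1\<in>tangent_space M F x. \<forall>X2\<in>tangent_space M F x.
          \<forall>X3\<in>tangent_space M F x. \<forall>X4\<in>tangent_space M F x.
            Rstar M F \<xi> x X1 X2 X3 X4 =
            \<phi> x / 2 * kulkarni_nomizu
              (\<lambda>X Y. Ric_Rstar M F \<xi> x X Y - l1 x * l2 x * blaschke_metric M F \<xi> x X Y)
              (\<lambda>X Y. Ric_Rstar M F \<xi> x X Y - l1 x * l2 x * blaschke_metric M F \<xi> x X Y)
              X1 X2 X3 X4"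
      by (intro part2) blast
  next
    assume *: "\<forall>x\<in>topspace M.
          two_curvatures_mult M F \<xi> x (l1 x) (l2 x) (k x) \<and>
          k x \<ge> 2 \<and> CARD('n) - k x \<ge> 2 \<and>
          ((l1 x > 0 \<and> l2 x > 0) \<or> (l1 x < 0 \<and> l2 x < 0) \<or>
           (l1 x \<noteq> 0 \<and> l2 x = 0) \<or> (l1 x = 0 \<and> l2 x \<noteq> 0))"
    \<comment> \<open>Truncated subtraction is harmless here: a difference of at least 2 forces
      \<open>k x\<close> below \<open>CARD('n)\<close>.\<close>
    have k: "k x \<le> CARD('n) - 2" if "CARD('n) - k x \<ge> 2" for x
      using that by arith
    show "\<forall>x\<in>topspace M.
          (real (k x) - 1) * l1 x + (real CARD('n) - real (k x) - 1) * l2 x \<noteq> 0 \<and>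
          2 \<le> k x \<and> k x \<le> CARD('n) - 2"
      using * star k by blast
    show "\<exists>\<phi> :: 'a \<Rightarrow> real. \<forall>x\<in>topspace M.
          \<forall>X1\<in>tangent_space M F x. \<forall>X2\<in>tangent_space M F x.
          \<forall>X3\<in>tangent_space M F x. \<forall>X4\<in>tangent_space M F x.
            Rstar M F \<xi> x X1 X2 X3 X4 =
            \<phi> x / 2 * kulkarni_nomizu
              (\<lambda>X Y. Ric_Rstar M F \<xi> x X Y - l1 x * l2 x * blaschke_metric M F \<xi> x X Y)
              (\<lambda>X Y. Ric_Rstar M F \<xi> x X Y - l1 x * l2 x * blaschke_metric M F \<xi> x X Y)
              X1 X2 X3 X4"
      by (intro part2 conjI star) (use * in blast)+
  next
    show "two_quasi_umbilical M F \<xi>"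
      if "CARD('n) = 4 \<and> (\<forall>x\<in>topspace M. two_curvatures_mult M F \<xi> x (l1 x) (l2 x) 2)"
      unfolding two_quasi_umbilical_def
    proof
      fix x assume "x \<in> topspace M"
      then show "two_quasi_umbilical_at M F \<xi> x"
        using two_quasi_umbilical_at_mult_2[OF hyp normal convex] that by blast
    qed
  qed
qed

end
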